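(* Let $r,s,n$ be positive integers and let $p$ be an odd prime. If there is a sums-of-squares formula of type $[r,s,n]$ over the algebraic closure $\overline{\mathbb{F}}_p$ of $\mathbb{F}_p$, then there is a sums-of-squares formula of type $[r,s,n]$ over $\mathbb{F}_{p^k}$ for some positive integer $k\leq 2\cdot 17^{rsn+r^2s^2}$.
   Context: Let $F$ be a field of characteristic not $2$. A sums-of-squares formula of type $[r,s,n]$ over $F$ is a polynomial identity $(x_1^2+\cdots+x_r^2)(y_1^2+\cdots+y_s^2)=z_1^2+\cdots+z_n^2$ in the polynomial ring $F[x_1,\dots,x_r,y_1,\dots,y_s]$, where each $z_i$ is a bilinear expression in the $x$'s and $y$'s over $F$, i.e. $z_i=\sum_{j,k}\alpha_{ijk}x_jy_k$ with $\alpha_{ijk}\in F$. $\mathbb{F}_{p^k}$ denotes the field with $p^k$ elements. *)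

theory Defs
  imports
    "HOL-Algebra.Algebraic_Closure_Type"
    "HOL-Library.Poly_Mapping"
begin

datatype sos_var = XVar nat | YVar nat

text \<open>
  Multivariate polynomials are finitely supported maps from monomials to coefficients, where a
  monomial is a finitely supported map from variables to exponents; the ring operations
  (convolution product) are those of \<^theory>\<open>HOL-Library.Poly_Mapping\<close>.
\<close>

type_synonym 'a sos_poly = "(sos_var \<Rightarrow>\<^sub>0 nat) \<Rightarrow>\<^sub>0 'a"

definition sos_const :: "'a::field \<Rightarrow> 'a sos_poly" where
  "sos_const c = Poly_Mapping.single 0 c"

definition sos_x :: "nat \<Rightarrow> 'a::field sos_poly" where
  "sos_x j = Poly_Mapping.single (Poly_Mapping.single (XVar j) 1) 1"

definition sos_y :: "nat \<Rightarrow> 'a::field sos_poly" where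
  "sos_y k = Poly_Mapping.single (Poly_Mapping.single (YVar k) 1) 1"

text \<open>
  A sums-of-squares formula of type $[r,s,n]$ over a subfield \<open>F\<close> of the field \<open>'a\<close> (with
  \<open>F = UNIV\<close> for the whole field). Only the variables $x_1,\dots,x_r,y_1,\dots,y_s$ occur. The
  identity is stated in the polynomial ring over \<open>'a\<close>, of which the polynomials with coefficients
  in \<open>F\<close> form a subring; all polynomials involved have coefficients in \<open>F\<close> because
  the \<open>\<alpha> i j k\<close> do.
\<close>

definition sums_of_squares_formula :: "'a::field set \<Rightarrow> nat \<Rightarrow> nat \<Rightarrow> nat \<Rightarrow> bool" where
  "sums_of_squares_formula F r s n \<longleftrightarrow>
     (\<exists>\<alpha> :: nat \<Rightarrow> nat \<Rightarrow> nat \<Rightarrow> 'a.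
        (\<forall>i\<in>{1..n}. \<forall>j\<in>{1..r}. \<forall>k\<in>{1..s}. \<alpha> i j k \<in> F) \<and>
        (\<Sum>j=1..r. sos_x j ^ 2) * (\<Sum>k=1..s. sos_y k ^ 2) =
        (\<Sum>i=1..n. (\<Sum>j=1..r. \<Sum>k=1..s. sos_const (\<alpha> i j k) * sos_x j * sos_y k) ^ 2))"

end

theory Submission
  imports Defs "Jordan_Normal_Form.Determinant" "HOL-Number_Theory.Residues"
begin

hide_const (open) Polynomials.degree Polynomials.lead_coeff UnivPoly.monom UnivPoly.coeff

text \<open>
  Comparing coefficients turns a formula of type $[r,s,n]$ into a system of quadratic equations in
  $N = rsn$ unknowns over the prime field. Classical elimination by resultants shows that the values
  of a coordinate on the zeros of such a system either satisfy a nonzero polynomial or omit at most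
  $2^{2^N}$ elements. Hence one can successively fix coordinates in the field with $q = p^{2^N}$
  elements until the remaining system has only finitely many zeros. These number at most $3^N$, by an
  elementary form of Bezout's theorem, and they are permuted by the $q$-th power map, so each of them
  has coordinates in a field with $p^k$ elements for some $k \le 2^N 3^N = 6^N$.
\<close>

section \<open>Polynomial functions\<close>

text \<open>Elimination and counting are both needed because they enter \<open>k\<close>
  differently. Since \<open>k\<close> is the logarithm of a field size, a doubly exponential number
  of exceptional values costs only the factor \<open>2 ^ N\<close>. The length of a Frobenius orbit,
  however, multiplies \<open>k\<close> directly, and degree bounds from iterated resultants are far
  too large for it. The orbit bound therefore comes from a dimension count. If an ideal
  \<open>I\<close> is generated by quadrics and every function reduces modulo \<open>I\<close> to
  degree at most \<open>e\<close>, then every function reduces modulo \<open>I ^ (e + 1)\<close> to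
  degree at most \<open>e + 2 * e\<close>. Each zero, on the other side, contributes as many
  independent functions as there are monomials of degree at most \<open>e\<close>. Passing from
  degree \<open>e\<close> to \<open>3 * e\<close> multiplies the number of monomials by at most
  \<open>3 ^ N\<close>, whatever \<open>e\<close> is, so an enormous \<open>e\<close> does no harm
  and no multiplicities or limits enter. The fixed coordinates must lie in the field with
  \<open>q\<close> elements, not just anywhere: otherwise the equations that fix them would not be
  respected by the q-th power map.\<close>

text \<open>Over an infinite field polynomials in \<open>x\<^sub>0, \<dots>, x\<^sub>n\<^sub>-\<^sub>1\<close> may be treated as functions; \<open>d\<close> is an
  upper bound for the total degree.\<close>

inductive poly_fun :: "nat \<Rightarrow> nat \<Rightarrow> ((nat \<Rightarrow> 'a::comm_ring_1) \<Rightarrow> 'a) \<Rightarrow> bool" for n where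
  const: "poly_fun n d (\<lambda>x. c)"
| add: "poly_fun n d f \<Longrightarrow> poly_fun n d g \<Longrightarrow> poly_fun n d (\<lambda>x. f x + g x)"
| var: "i < n \<Longrightarrow> poly_fun n d f \<Longrightarrow> poly_fun n (Suc d) (\<lambda>x. x i * f x)"

lemma poly_fun_mono:
  assumes "poly_fun n d f" "d \<le> e" "n \<le> m"
  shows "poly_fun m e f"
  using assms
proof (induction arbitrary: e rule: poly_fun.induct)
  case (var i d f)
  then obtain e' where "e = Suc e'" "d \<le> e'" by (cases e) auto
  with var show ?case by (auto intro!: poly_fun.var)
qed (auto intro: poly_fun.intros)

lemma poly_fun_cmult: "poly_fun n d f \<Longrightarrow> poly_fun n d (\<lambda>x. c * f x)"
proof (induction rule: poly_fun.induct)
  case (var i d f)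
  from poly_fun.var[OF var(1,3)] show ?case by (simp add: mult.left_commute)
qed (auto intro: poly_fun.intros simp: distrib_left)

lemma poly_fun_mult:
  assumes "poly_fun n d f" "poly_fun n e g"
  shows "poly_fun n (d + e) (\<lambda>x. f x * g x)"
  using assms
proof (induction rule: poly_fun.induct)
  case (const d c)
  then show ?case using poly_fun_mono[OF poly_fun_cmult[of n e g c], of "d + e" n] by simp
next
  case (add d f g')
  then show ?case by (simp add: distrib_right poly_fun.add)
next
  case (var i d f)
  then show ?case using poly_fun.var[OF var(1) var.IH] by (simp add: mult.assoc)
qed

lemma poly_fun_var: "i < n \<Longrightarrow> poly_fun n (Suc d) (\<lambda>x. x i)"
  using poly_fun.var[OF _ poly_fun.const[of n d 1]] by simp

lemma poly_fun_diff: "poly_fun n d f \<Longrightarrow> poly_fun n d g \<Longrightarrow> poly_fun n d (\<lambda>x. f x - g x)"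
  using poly_fun.add[OF _ poly_fun_cmult[of n d g "-1"], of f] by simp

lemma poly_fun_sum: "(\<And>i. i \<in> A \<Longrightarrow> poly_fun n d (f i)) \<Longrightarrow> poly_fun n d (\<lambda>x. \<Sum>i\<in>A. f i x)"
  by (induction A rule: infinite_finite_induct) (auto intro: poly_fun.intros)

lemma poly_fun_prod:
  "(\<And>i. i \<in> A \<Longrightarrow> poly_fun n (d i) (f i)) \<Longrightarrow> poly_fun n (\<Sum>i\<in>A. d i) (\<lambda>x. \<Prod>i\<in>A. f i x)"
  by (induction A rule: infinite_finite_induct) (auto intro: poly_fun.intros poly_fun_mult)

lemma poly_fun_power: "poly_fun n d f \<Longrightarrow> poly_fun n (k * d) (\<lambda>x. f x ^ k)"
  by (induction k) (auto intro: poly_fun.intros poly_fun_mult)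

lemma poly_fun_subst:
  assumes "poly_fun n d f" "\<And>i. i < n \<Longrightarrow> poly_fun m 1 (s i)"
  shows "poly_fun m d (\<lambda>x. f (\<lambda>i. s i x))"
  using assms
proof (induction rule: poly_fun.induct)
  case (var i d f)
  then show ?case using poly_fun_mult[of m 1 "s i" d "\<lambda>x. f (\<lambda>i. s i x)"] by simp
qed (auto intro: poly_fun.intros)

lemma poly_fun_cong:
  assumes "poly_fun n d f" "\<And>i. i < n \<Longrightarrow> x i = y i"
  shows "f x = f y"
  using assms by (induction rule: poly_fun.induct) auto

text \<open>Each coefficient gets the coarse bound \<open>d\<close> instead of \<open>d - i\<close>;
  all entries of a Sylvester matrix then share one degree bound.\<close>

lemma poly_fun_last_var:
  assumes "poly_fun (Suc n) d f"
  shows "\<exists>a. (\<forall>i. poly_fun n d (a i)) \<and> (\<forall>x. f x = (\<Sum>i\<le>d. a i x * x n ^ i))"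
  using assms
proof (induction rule: poly_fun.induct)
  case (const d c)
  have "(\<Sum>i\<le>d. (if i = 0 then c else 0) * x n ^ i) = c" for x :: "nat \<Rightarrow> 'a"
    by (subst sum.remove[of _ 0]) auto
  then show ?case
    by (intro exI[of _ "\<lambda>i x. if i = 0 then c else 0"]) (auto intro: poly_fun.const)
next
  case (add d f g)
  then obtain a b where "\<forall>i. poly_fun n d (a i)" "\<forall>i. poly_fun n d (b i)"
    "\<forall>x. f x = (\<Sum>i\<le>d. a i x * x n ^ i)" "\<forall>x. g x = (\<Sum>i\<le>d. b i x * x n ^ i)"
    by blast
  then show ?case
    by (intro exI[of _ "\<lambda>i x. a i x + b i x"])
      (auto intro: poly_fun.add simp: distrib_right sum.distrib)
next
  case (var j d f)
  then obtain a where a: "\<And>i. poly_fun n d (a i)" "\<And>x. f x = (\<Sum>i\<le>d. a i x * x n ^ i)"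
    by blast
  show ?case
  proof (cases "j = n")
    case True
    have "x j * f x = (\<Sum>i\<le>Suc d. (case i of 0 \<Rightarrow> 0 | Suc i \<Rightarrow> a i x) * x n ^ i)" for x
      unfolding sum.atMost_Suc_shift using True by (simp add: a sum_distrib_left mult_ac)
    moreover have "poly_fun n (Suc d) (\<lambda>x. case i of 0 \<Rightarrow> 0 | Suc i \<Rightarrow> a i x)" for i
      by (cases i) (auto intro: poly_fun.const poly_fun_mono[OF a(1)])
    ultimately show ?thesis
      by (intro exI[of _ "\<lambda>i x. case i of 0 \<Rightarrow> 0 | Suc i \<Rightarrow> a i x"]) blast
  next
    case False
    with var have j: "j < n" by simp
    have "x j * f x = (\<Sum>i\<le>Suc d. (if i \<le> d then x j * a i x else 0) * x n ^ i)" for x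
      by (simp add: a sum_distrib_left mult_ac)
    moreover have "poly_fun n (Suc d) (\<lambda>x. if i \<le> d then x j * a i x else 0)" for i
      by (cases "i \<le> d") (auto intro: poly_fun.const poly_fun.var[OF j] a(1))
    ultimately show ?thesis
      by (intro exI[of _ "\<lambda>i x. if i \<le> d then x j * a i x else 0"]) blast
  qed
qed

text \<open>Restriction to the curve parametrised by \<open>u\<close>. Curves of high degree occur
  when zeros are counted; the degree bound, for lines, controls the leading coefficient in the
  elimination step.\<close>

lemma poly_fun_univariate:
  fixes u :: "nat \<Rightarrow> 'a::comm_ring_1 poly"
  assumes "poly_fun n d f"
  shows "\<exists>q. (\<forall>t. poly q t = f (\<lambda>i. poly (u i) t)) \<and>
    ((\<forall>i<n. degree (u i) \<le> 1) \<longrightarrow> degree q \<le> d)"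
  using assms
proof (induction rule: poly_fun.induct)
  case (const d c)
  show ?case by (intro exI[of _ "[:c:]"]) auto
next
  case (add d f g)
  then obtain q r where "\<forall>t. poly q t = f (\<lambda>i. poly (u i) t)" "\<forall>t. poly r t = g (\<lambda>i. poly (u i) t)"
    "(\<forall>i<n. degree (u i) \<le> 1) \<longrightarrow> degree q \<le> d" "(\<forall>i<n. degree (u i) \<le> 1) \<longrightarrow> degree r \<le> d"
    by blast
  then show ?case by (intro exI[of _ "q + r"]) (auto intro: degree_add_le)
next
  case (var j d f)
  then obtain q where q: "\<forall>t. poly q t = f (\<lambda>i. poly (u i) t)"
    "(\<forall>i<n. degree (u i) \<le> 1) \<longrightarrow> degree q \<le> d" by blast
  have "degree (u j * q) \<le> Suc d" if "\<forall>i<n. degree (u i) \<le> 1"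
    using degree_mult_le[of "u j" q] q(2) that var(1) by fastforce
  with q show ?case by (intro exI[of _ "u j * q"]) auto
qed

text \<open>Homogeneous of degree \<open>j\<close> in \<open>x\<^sub>1, \<dots>, x\<^sub>m\<close> only; \<open>x\<^sub>0\<close> plays the role of a parameter.\<close>

inductive hom_fun :: "nat \<Rightarrow> nat \<Rightarrow> nat \<Rightarrow> ((nat \<Rightarrow> 'a::comm_ring_1) \<Rightarrow> 'a) \<Rightarrow> bool" for m where
  const: "hom_fun m 0 d (\<lambda>x. c)"
| zero: "hom_fun m j d (\<lambda>x. 0)"
| add: "hom_fun m j d f \<Longrightarrow> hom_fun m j d g \<Longrightarrow> hom_fun m j d (\<lambda>x. f x + g x)"
| var0: "hom_fun m j d f \<Longrightarrow> hom_fun m j (Suc d) (\<lambda>x. x 0 * f x)"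
| var: "0 < i \<Longrightarrow> i \<le> m \<Longrightarrow> hom_fun m j d f \<Longrightarrow> hom_fun m (Suc j) (Suc d) (\<lambda>x. x i * f x)"

lemma hom_fun_poly_fun: "hom_fun m j d f \<Longrightarrow> poly_fun (Suc m) d f"
  by (induction rule: hom_fun.induct) (auto intro: poly_fun.intros)

lemma poly_fun_hom_parts:
  assumes "poly_fun (Suc m) d f"
  shows "\<exists>h. (\<forall>j. hom_fun m j d (h j)) \<and> (\<forall>x. f x = (\<Sum>j\<le>d. h j x))"
  using assms
proof (induction rule: poly_fun.induct)
  case (const d c)
  have "(\<Sum>j\<le>d. (if j = 0 then c else 0)) = c" by simp
  moreover have "hom_fun m j d (\<lambda>x. if j = 0 then c else 0)" for j
    by (cases "j = 0") (auto intro: hom_fun.const hom_fun.zero)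
  ultimately show ?case by (intro exI[of _ "\<lambda>j x. if j = 0 then c else 0"]) auto
next
  case (add d f g)
  then obtain a b where "\<forall>j. hom_fun m j d (a j)" "\<forall>j. hom_fun m j d (b j)"
    "\<forall>x. f x = (\<Sum>j\<le>d. a j x)" "\<forall>x. g x = (\<Sum>j\<le>d. b j x)"
    by blast
  then show ?case
    by (intro exI[of _ "\<lambda>j x. a j x + b j x"]) (auto intro: hom_fun.add simp: sum.distrib)
next
  case (var i d f)
  then obtain a where a: "\<And>j. hom_fun m j d (a j)" "\<And>x. f x = (\<Sum>j\<le>d. a j x)"
    by blast
  show ?case
  proof (cases "i = 0")
    case True
    have "x i * f x = (\<Sum>j\<le>Suc d. if j \<le> d then x 0 * a j x else 0)" for x
      by (simp add: a sum_distrib_left True)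
    moreover have "hom_fun m j (Suc d) (\<lambda>x. if j \<le> d then x 0 * a j x else 0)" for j
      by (cases "j \<le> d") (auto intro: hom_fun.zero hom_fun.var0 a(1))
    ultimately show ?thesis
      by (intro exI[of _ "\<lambda>j x. if j \<le> d then x 0 * a j x else 0"]) blast
  next
    case False
    with var have i: "0 < i" "i \<le> m" by simp_all
    have "x i * f x = (\<Sum>j\<le>Suc d. case j of 0 \<Rightarrow> 0 | Suc j \<Rightarrow> x i * a j x)" for x
      unfolding sum.atMost_Suc_shift by (simp add: a sum_distrib_left)
    moreover have "hom_fun m j (Suc d) (\<lambda>x. case j of 0 \<Rightarrow> 0 | Suc j \<Rightarrow> x i * a j x)" for j
      by (cases j) (auto intro: hom_fun.zero hom_fun.var[OF i] a(1))
    ultimately show ?thesis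
      by (intro exI[of _ "\<lambda>j x. case j of 0 \<Rightarrow> 0 | Suc j \<Rightarrow> x i * a j x"]) blast
  qed
qed

lemma hom_fun_0: "hom_fun m j d f \<Longrightarrow> j = 0 \<Longrightarrow> f x = f (\<lambda>i. if i = 0 then x 0 else 0)"
  by (induction rule: hom_fun.induct) auto

text \<open>The linear change of variables that replaces the direction of the last variable by \<open>v\<close>.\<close>

definition shear :: "nat \<Rightarrow> (nat \<Rightarrow> 'a::comm_ring_1) \<Rightarrow> (nat \<Rightarrow> 'a) \<Rightarrow> nat \<Rightarrow> 'a" where
  "shear m v x i = (if i = 0 \<or> i > m then x i else if i = m then v m * x m else x i + v i * x m)"

text \<open>Only the multiples of \<open>x m\<close> added by the shear can produce the top power of
  \<open>x m\<close>, so its coefficient is the value of \<open>f\<close> in the direction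
  \<open>v\<close>. Hence it depends on \<open>x 0\<close> alone, as in Noether normalisation with a
  parameter.\<close>

lemma hom_fun_shear:
  assumes "hom_fun m j d f" "m > 0"
  shows "\<exists>a. (\<forall>i. poly_fun m d (a i)) \<and>
    (\<forall>x. f (shear m v x) = (\<Sum>i<j. a i x * x m ^ i) + f (\<lambda>i. if i = 0 then x 0 else v i) * x m ^ j)"
  using assms
proof (induction rule: hom_fun.induct)
  case (const d c)
  then show ?case by (intro exI[of _ "\<lambda>i x. 0"]) (auto intro: poly_fun.const)
next
  case (zero j d)
  then show ?case by (intro exI[of _ "\<lambda>i x. 0"]) (auto intro: poly_fun.const)
next
  case (add j d f g)
  then obtain a b where "\<forall>i. poly_fun m d (a i)" "\<forall>i. poly_fun m d (b i)"
    "\<forall>x. f (shear m v x) = (\<Sum>i<j. a i x * x m ^ i) + f (\<lambda>i. if i = 0 then x 0 else v i) * x m ^ j"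
    "\<forall>x. g (shear m v x) = (\<Sum>i<j. b i x * x m ^ i) + g (\<lambda>i. if i = 0 then x 0 else v i) * x m ^ j"
    by blast
  then show ?case
    by (intro exI[of _ "\<lambda>i x. a i x + b i x"])
      (auto intro: poly_fun.add simp: sum.distrib algebra_simps)
next
  case (var0 j d f)
  then obtain a where "\<forall>i. poly_fun m d (a i)"
    "\<forall>x. f (shear m v x) = (\<Sum>i<j. a i x * x m ^ i) + f (\<lambda>i. if i = 0 then x 0 else v i) * x m ^ j"
    by blast
  with \<open>m > 0\<close> show ?case
    by (intro exI[of _ "\<lambda>i x. x 0 * a i x"])
      (auto intro: poly_fun.var simp: sum_distrib_left algebra_simps shear_def[of m v _ 0])
next
  case (var k j d f)
  define F where "F = (\<lambda>x :: nat \<Rightarrow> 'a. f (\<lambda>i. if i = 0 then x 0 else v i))"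
  from var obtain a where a: "\<And>i. poly_fun m d (a i)"
    "\<And>x. f (shear m v x) = (\<Sum>i<j. a i x * x m ^ i) + F x * x m ^ j"
    unfolding F_def by blast
  have F: "poly_fun m d F"
    unfolding F_def using hom_fun_poly_fun[OF var(3)]
  proof (rule poly_fun_subst)
    fix i assume "i < Suc m"
    show "poly_fun m 1 (\<lambda>x. if i = 0 then x 0 else v i)"
      using \<open>m > 0\<close> poly_fun_var[of 0 m 0, where 'a = 'a] by (cases "i = 0") (auto intro: poly_fun.const)
  qed
  \<comment> \<open>The sheared coordinate \<open>x k\<close> is \<open>u x + v k * x m\<close>.
    Multiplication by \<open>u\<close> keeps the powers of \<open>x m\<close> (coefficients
    \<open>b\<close>, with \<open>F\<close> as the last one); multiplication by
    \<open>v k * x m\<close> shifts them (coefficients \<open>b'\<close>) and sends the top term to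
    the new top term.\<close>
  define b where "b = (\<lambda>i x. if i < j then a i x else F x)"
  define b' where "b' = (\<lambda>i x. case i of 0 \<Rightarrow> 0 | Suc i \<Rightarrow> v k * a i x)"
  define u where "u = (\<lambda>x :: nat \<Rightarrow> 'a. if k = m then 0 else x k)"
  have u: "poly_fun m (Suc d) (\<lambda>x. u x * b i x)" for i
    using var(1,2) F a(1) unfolding u_def b_def
    by (cases "k = m"; cases "i < j") (auto intro: poly_fun.const poly_fun.var)
  have b': "poly_fun m (Suc d) (b' i)" for i
    unfolding b'_def
    by (cases i) (auto intro: poly_fun.const poly_fun_cmult[OF poly_fun_mono[OF a(1)]])
  have "shear m v x k * f (shear m v x) =
    (\<Sum>i<Suc j. (u x * b i x + b' i x) * x m ^ i) + v k * F x * x m ^ Suc j" for x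
  proof -
    have 1: "shear m v x k = u x + v k * x m" using var(1,2) by (auto simp: shear_def u_def)
    have "(\<Sum>i<j. a i x * x m ^ i) + F x * x m ^ j = (\<Sum>i<Suc j. b i x * x m ^ i)"
      by (simp add: b_def)
    moreover have "v k * x m * (\<Sum>i<j. a i x * x m ^ i) = (\<Sum>i<Suc j. b' i x * x m ^ i)"
      unfolding sum.lessThan_Suc_shift by (simp add: b'_def sum_distrib_left mult_ac)
    moreover have "(u x + v k * x m) * (A + F x * x m ^ j) =
      u x * (A + F x * x m ^ j) + v k * x m * A + v k * F x * x m ^ Suc j" for A
      by (simp add: algebra_simps)
    ultimately have "(u x + v k * x m) * f (shear m v x) =
      u x * (\<Sum>i<Suc j. b i x * x m ^ i) + (\<Sum>i<Suc j. b' i x * x m ^ i) + v k * F x * x m ^ Suc j"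
      unfolding a by metis
    then show ?thesis
      unfolding 1 by (simp only: distrib_right sum.distrib sum_distrib_left mult.assoc)
  qed
  moreover have "poly_fun m (Suc d) (\<lambda>x. u x * b i x + b' i x)" for i
    by (rule poly_fun.add[OF u b'])
  ultimately show ?case
    using var(1) by (intro exI[of _ "\<lambda>i x. u x * b i x + b' i x"]) (auto simp: F_def)
qed

section \<open>Sylvester matrices\<close>

lemma infinite_UNIV_alg_closed: "infinite (UNIV :: 'a::alg_closed_field set)"
proof
  assume fin: "finite (UNIV :: 'a set)"
  define q where "q = (\<Prod>a\<in>(UNIV :: 'a set). [:-a, 1:])"
  have "degree q = card (UNIV :: 'a set)"
    unfolding q_def by (subst degree_prod_eq_sum_degree) auto
  with fin have "degree (q + 1) > 0"
    by (subst degree_add_eq_left) (auto simp: card_gt_0_iff)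
  then obtain x where "poly (q + 1) x = 0" using alg_closed_imp_poly_has_root by blast
  moreover have "poly q x = 0"
    using fin by (auto simp: q_def poly_prod prod_zero_iff)
  ultimately show False by simp
qed

text \<open>Over an algebraically closed field, having no common root means being coprime. The
  linear factors of \<open>f\<close> are split off from \<open>v\<close> one at a time.\<close>

lemma dvd_mult_no_common_root:
  fixes f g v :: "'a::alg_closed_field poly"
  assumes "f \<noteq> 0" "\<And>x. poly f x = 0 \<Longrightarrow> poly g x \<noteq> 0" "f dvd v * g"
  shows "f dvd v"
  using assms
proof (induction "degree f" arbitrary: f v)
  case 0
  then have "f dvd 1" by (simp add: is_unit_iff_degree)
  then show ?case by (rule dvd_trans) simp
next
  case (Suc n)
  from Suc.hyps(2) obtain x where x: "poly f x = 0"
    using alg_closed_imp_poly_has_root[of f] by auto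
  then obtain f1 where f1: "f = [:-x, 1:] * f1" by (auto simp: poly_eq_0_iff_dvd elim: dvdE)
  from Suc.prems(3) x have "poly v x * poly g x = 0"
    by (metis dvdE mult_zero_left poly_mult)
  with Suc.prems(2)[OF x] have "poly v x = 0" by simp
  then obtain v1 where v1: "v = [:-x, 1:] * v1" by (auto simp: poly_eq_0_iff_dvd elim: dvdE)
  have "f1 \<noteq> 0" using Suc.prems(1) f1 by auto
  then have "degree f = Suc (degree f1)" unfolding f1 by (subst degree_mult_eq) auto
  moreover have "f1 dvd v1 * g"
    using Suc.prems(3) unfolding f1 v1 by (subst (asm) mult.assoc) (simp only: dvd_mult_cancel_left, simp)
  moreover have "poly g y \<noteq> 0" if "poly f1 y = 0" for y
    using Suc.prems(2)[of y] that by (simp add: f1)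
  ultimately have "f1 dvd v1" using Suc.hyps(1)[of f1 v1] Suc.hyps(2) \<open>f1 \<noteq> 0\<close> by auto
  then show ?case unfolding f1 v1 by (rule mult_dvd_mono[OF dvd_refl])
qed

text \<open>The Sylvester matrix of \<open>\<Sum>i\<le>k. a i * t ^ i\<close> and \<open>\<Sum>i\<le>d. b i * t ^ i\<close>, whose rows
  are the coefficients, in increasing order, of multiples of these two polynomials by powers of \<open>t\<close>.\<close>

definition sylvester :: "nat \<Rightarrow> nat \<Rightarrow> (nat \<Rightarrow> 'a::comm_ring_1) \<Rightarrow> (nat \<Rightarrow> 'a) \<Rightarrow> 'a mat" where
  "sylvester k d a b = mat (d + k) (d + k) (\<lambda>(r, c).
     if r < d then (if r \<le> c \<and> c \<le> r + k then a (c - r) else 0)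
     else (if r - d \<le> c \<and> c \<le> r then b (c - (r - d)) else 0))"

lemma sylvester_carrier: "sylvester k d a b \<in> carrier_mat (d + k) (d + k)"
  by (simp add: sylvester_def)

lemma sum_shifted_coeffs:
  fixes t :: "'a::comm_ring_1"
  assumes "r + k < n"
  shows "(\<Sum>c<n. (if r \<le> c \<and> c \<le> r + k then a (c - r) else 0) * t ^ c) = t ^ r * (\<Sum>i\<le>k. a i * t ^ i)"
proof -
  have "(\<Sum>c<n. (if r \<le> c \<and> c \<le> r + k then a (c - r) else 0) * t ^ c) =
    (\<Sum>c\<in>{r..r+k}. a (c - r) * t ^ c)"
    using assms by (intro sum.mono_neutral_cong_right) auto
  also have "\<dots> = (\<Sum>i\<in>{..k}. a i * t ^ (i + r))"
    by (rule sum.reindex_bij_witness[of _ "\<lambda>i. i + r" "\<lambda>c. c - r"]) auto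
  finally show ?thesis by (simp add: sum_distrib_left power_add mult_ac)
qed

text \<open>The product of the matrix with the vector of powers of \<open>t\<close>. It is applied
  both to elements \<open>t\<close> of the ground ring and to the indeterminate of a polynomial
  ring.\<close>

lemma sylvester_row:
  fixes t :: "'a::comm_ring_1"
  assumes "r < d + k"
  shows "(\<Sum>c<d+k. sylvester k d a b $$ (r, c) * t ^ c) =
    (if r < d then t ^ r * (\<Sum>i\<le>k. a i * t ^ i) else t ^ (r - d) * (\<Sum>i\<le>d. b i * t ^ i))"
proof (cases "r < d")
  case True
  then have "(\<Sum>c<d+k. sylvester k d a b $$ (r, c) * t ^ c) =
    (\<Sum>c<d+k. (if r \<le> c \<and> c \<le> r + k then a (c - r) else 0) * t ^ c)"
    using assms by (intro sum.cong) (auto simp: sylvester_def)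
  with True show ?thesis by (simp add: sum_shifted_coeffs)
next
  case False
  then have "(\<Sum>c<d+k. sylvester k d a b $$ (r, c) * t ^ c) =
    (\<Sum>c<d+k. (if r - d \<le> c \<and> c \<le> (r - d) + d then b (c - (r - d)) else 0) * t ^ c)"
    using assms by (intro sum.cong) (auto simp: sylvester_def)
  also have "\<dots> = t ^ (r - d) * (\<Sum>i\<le>d. b i * t ^ i)"
    using False assms by (intro sum_shifted_coeffs) simp
  finally show ?thesis using False by simp
qed

lemma sum_lessThan_add:
  fixes h :: "nat \<Rightarrow> 'a::comm_monoid_add"
  shows "(\<Sum>r<d+k. h r) = (\<Sum>r<d. h r) + (\<Sum>j<k. h (d + j))"
  by (induction k) (auto simp: add.assoc)

lemma const_poly_sum: "[:\<Sum>r\<in>A. h r:] = (\<Sum>r\<in>A. [:h r:])"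
  by (rule poly_eqI) (simp add: coeff_sum coeff_pCons sum.neutral split: nat.splits)

text \<open>The resultant lies in the ideal generated by the two polynomials: take column 0 of the
  adjugate identity and multiply the matrix by the vector of powers of \<open>t\<close>. The
  explicit cofactors matter because they are polynomial in the coefficients.\<close>

lemma det_sylvester_combination:
  fixes t :: "'a::comm_ring_1"
  assumes "0 < d + k"
  shows "det (sylvester k d a b) =
    (\<Sum>r<d. cofactor (sylvester k d a b) r 0 * t ^ r) * (\<Sum>i\<le>k. a i * t ^ i) +
    (\<Sum>j<k. cofactor (sylvester k d a b) (d + j) 0 * t ^ j) * (\<Sum>i\<le>d. b i * t ^ i)"
proof -
  define S where "S = sylvester k d a b"
  define F where "F = (\<Sum>i\<le>k. a i * t ^ i)"
  define G where "G = (\<Sum>i\<le>d. b i * t ^ i)"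
  have S: "S \<in> carrier_mat (d + k) (d + k)" unfolding S_def by (rule sylvester_carrier)
  have col: "(\<Sum>r<d+k. cofactor S r 0 * S $$ (r, c)) = (if c = 0 then det S else 0)" if "c < d + k" for c
  proof -
    have "(adj_mat S * S) $$ (0, c) = (\<Sum>r<d+k. cofactor S r 0 * S $$ (r, c))"
      using S that assms adj_mat(1)[OF S]
      by (auto simp: adj_mat_def scalar_prod_def lessThan_atLeast0 intro!: sum.cong)
    then show ?thesis using adj_mat(3)[OF S] that assms by (auto split: if_splits)
  qed
  have "det S = (\<Sum>c<d+k. (if c = 0 then det S else 0) * t ^ c)"
    using assms by (subst sum.remove[of _ 0]) auto
  also have "\<dots> = (\<Sum>c<d+k. (\<Sum>r<d+k. cofactor S r 0 * S $$ (r, c)) * t ^ c)"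
    by (intro sum.cong) (auto simp: col)
  also have "\<dots> = (\<Sum>r<d+k. cofactor S r 0 * (\<Sum>c<d+k. S $$ (r, c) * t ^ c))"
    by (simp only: sum_distrib_left sum_distrib_right mult.assoc) (rule sum.swap)
  also have "\<dots> = (\<Sum>r<d+k. cofactor S r 0 * (if r < d then t ^ r * F else t ^ (r - d) * G))"
    by (intro sum.cong) (auto simp: S_def F_def G_def sylvester_row)
  also have "\<dots> = (\<Sum>r<d. cofactor S r 0 * (t ^ r * F)) + (\<Sum>j<k. cofactor S (d + j) 0 * (t ^ j * G))"
    by (simp add: sum_lessThan_add)
  finally show ?thesis
    by (simp add: S_def F_def G_def sum_distrib_right mult.assoc)
qed

text \<open>A vector in the left kernel encodes \<open>P * f + Q * g = 0\<close> with
  \<open>degree Q < k\<close> and \<open>P\<close> of formal degree below \<open>d\<close>. As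
  \<open>f\<close> has exact degree \<open>k\<close> and shares no root with \<open>g\<close>, it
  divides \<open>Q\<close>, which forces \<open>Q = 0\<close> and \<open>P = 0\<close>. The degree
  of \<open>g\<close> may drop below \<open>d\<close>.\<close>

lemma det_sylvester_nonzero:
  fixes a b :: "nat \<Rightarrow> 'a::alg_closed_field"
  assumes "a k \<noteq> 0"
    and no_root: "\<And>t. (\<Sum>i\<le>k. a i * t ^ i) = 0 \<Longrightarrow> (\<Sum>i\<le>d. b i * t ^ i) \<noteq> 0"
  shows "det (sylvester k d a b) \<noteq> 0"
proof
  define S where "S = sylvester k d a b"
  define T :: "'a poly" where "T = [:0, 1:]"
  define f where "f = (\<Sum>i\<le>k. [:a i:] * T ^ i)"
  define g where "g = (\<Sum>i\<le>d. [:b i:] * T ^ i)"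
  have mon: "[:c:] * T ^ i = monom c i" for c i by (simp add: T_def monom_altdef)
  have S: "S \<in> carrier_mat (d + k) (d + k)" unfolding S_def by (rule sylvester_carrier)
  assume "det (sylvester k d a b) = 0"
  then have "det (transpose_mat S) = 0" using det_transpose[OF S] by (simp add: S_def)
  then obtain v where v: "v \<in> carrier_vec (d + k)" "v \<noteq> 0\<^sub>v (d + k)" "transpose_mat S *\<^sub>v v = 0\<^sub>v (d + k)"
    using det_0_iff_vec_prod_zero[of "transpose_mat S" "d + k"] S by auto
  have col: "(\<Sum>r<d+k. v $ r * S $$ (r, c)) = 0" if "c < d + k" for c
  proof -
    have "(transpose_mat S *\<^sub>v v) $ c = (\<Sum>r<d+k. v $ r * S $$ (r, c))"
      using S v(1) that by (auto simp: scalar_prod_def lessThan_atLeast0 mult.commute intro!: sum.cong)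
    with v(3) that show ?thesis by simp
  qed
  define P where "P = (\<Sum>r<d. monom (v $ r) r)"
  define Q where "Q = (\<Sum>j<k. monom (v $ (d + j)) j)"
  have Sc: "[:S $$ (r, c):] = sylvester k d (\<lambda>i. [:a i:]) (\<lambda>i. [:b i:]) $$ (r, c)"
    if "r < d + k" "c < d + k" for r c
    using that by (auto simp: S_def sylvester_def)
  have "0 = (\<Sum>c<d+k. [:\<Sum>r<d+k. v $ r * S $$ (r, c):] * T ^ c)"
    by (simp add: col)
  also have "\<dots> = (\<Sum>c<d+k. \<Sum>r<d+k. [:v $ r:] * ([:S $$ (r, c):] * T ^ c))"
  proof (rule sum.cong[OF refl])
    fix c
    have "[:\<Sum>r<d+k. v $ r * S $$ (r, c):] = (\<Sum>r<d+k. [:v $ r:] * [:S $$ (r, c):])"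
      by (simp add: const_poly_sum mult.commute)
    then show "[:\<Sum>r<d+k. v $ r * S $$ (r, c):] * T ^ c = (\<Sum>r<d+k. [:v $ r:] * ([:S $$ (r, c):] * T ^ c))"
      by (simp only: sum_distrib_right mult.assoc)
  qed
  also have "\<dots> = (\<Sum>r<d+k. [:v $ r:] * (\<Sum>c<d+k. [:S $$ (r, c):] * T ^ c))"
    by (subst sum.swap) (simp only: sum_distrib_left)
  also have "\<dots> = (\<Sum>r<d+k. [:v $ r:] * (if r < d then T ^ r * f else T ^ (r - d) * g))"
  proof (rule sum.cong[OF refl])
    fix r assume r: "r \<in> {..<d+k}"
    then have "(\<Sum>c<d+k. [:S $$ (r, c):] * T ^ c) =
      (\<Sum>c<d+k. sylvester k d (\<lambda>i. [:a i:]) (\<lambda>i. [:b i:]) $$ (r, c) * T ^ c)"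
      by (intro sum.cong) (simp_all only: Sc lessThan_iff)
    with r show "[:v $ r:] * (\<Sum>c<d+k. [:S $$ (r, c):] * T ^ c) =
      [:v $ r:] * (if r < d then T ^ r * f else T ^ (r - d) * g)"
      by (simp only: sylvester_row lessThan_iff f_def g_def)
  qed
  also have "\<dots> = (\<Sum>r<d. [:v $ r:] * (T ^ r * f)) + (\<Sum>j<k. [:v $ (d + j):] * (T ^ j * g))"
    by (simp add: sum_lessThan_add)
  also have "\<dots> = P * f + Q * g"
    unfolding P_def Q_def mon[symmetric] sum_distrib_right by (simp only: mult.assoc)
  finally have eq: "P * f + Q * g = 0" ..
  have coeff_f: "coeff f i = (if i \<le> k then a i else 0)" for i
    unfolding f_def mon by (simp add: coeff_sum)
  have "f \<noteq> 0" using coeff_f[of k] \<open>a k \<noteq> 0\<close> by auto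
  have "k \<le> degree f" using coeff_f[of k] \<open>a k \<noteq> 0\<close> by (intro le_degree) auto
  have coeff_P: "coeff P i = (if i < d then v $ i else 0)" for i
    unfolding P_def by (simp add: coeff_sum)
  have coeff_Q: "coeff Q i = (if i < k then v $ (d + i) else 0)" for i
    unfolding Q_def by (simp add: coeff_sum)
  have pf: "poly f t = (\<Sum>i\<le>k. a i * t ^ i)" "poly g t = (\<Sum>i\<le>d. b i * t ^ i)" for t
    by (simp_all add: f_def g_def T_def poly_sum)
  from eq have "Q * g = f * (- P)" by (simp add: algebra_simps eq_neg_iff_add_eq_0)
  then have "f dvd Q * g" by simp
  then have "f dvd Q" using \<open>f \<noteq> 0\<close> no_root by (intro dvd_mult_no_common_root[of f g Q]) (auto simp: pf)
  have "Q = 0"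
  proof (rule ccontr)
    assume "Q \<noteq> 0"
    then have "degree Q \<ge> k" using dvd_imp_degree_le[OF \<open>f dvd Q\<close>] \<open>k \<le> degree f\<close> by simp
    then have "coeff Q (degree Q) = 0" by (simp add: coeff_Q)
    with \<open>Q \<noteq> 0\<close> show False by simp
  qed
  with eq \<open>f \<noteq> 0\<close> have "P = 0" by simp
  have "v $ r = 0" if "r < d + k" for r
    using coeff_P[of r] coeff_Q[of "r - d"] that \<open>P = 0\<close> \<open>Q = 0\<close>
    by (cases "r < d") (auto split: if_splits)
  then have "v = 0\<^sub>v (d + k)" using v(1) by auto
  with v(2) show False ..
qed

lemma poly_fun_det:
  assumes "\<And>x. M x \<in> carrier_mat N N"
    and "\<And>i j. i < N \<Longrightarrow> j < N \<Longrightarrow> poly_fun n d (\<lambda>x. M x $$ (i, j))"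
  shows "poly_fun n (N * d) (\<lambda>x. det (M x))"
proof -
  have "det (M x) = (\<Sum>p\<in>{p. p permutes {0..<N}}. signof p * (\<Prod>i=0..<N. M x $$ (i, p i)))" for x
    using assms(1)[of x] by (simp add: det_def)
  moreover have "poly_fun n (N * d) (\<lambda>x. signof p * (\<Prod>i=0..<N. M x $$ (i, p i)))"
    if "p permutes {0..<N}" for p
  proof (rule poly_fun_cmult)
    have "poly_fun n (\<Sum>i=0..<N. d) (\<lambda>x. \<Prod>i=0..<N. M x $$ (i, p i))"
      using permutes_in_image[OF that] by (intro poly_fun_prod assms(2)) auto
    then show "poly_fun n (N * d) (\<lambda>x. \<Prod>i=0..<N. M x $$ (i, p i))" by simp
  qed
  ultimately show ?thesis by (auto intro: poly_fun_sum)
qed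

lemma poly_fun_cofactor:
  assumes "\<And>x. M x \<in> carrier_mat N N" "i < N" "j < N"
    and "\<And>i j. i < N \<Longrightarrow> j < N \<Longrightarrow> poly_fun n d (\<lambda>x. M x $$ (i, j))"
  shows "poly_fun n ((N - 1) * d) (\<lambda>x. cofactor (M x) i j)"
  unfolding cofactor_def
proof (rule poly_fun_cmult, rule poly_fun_det)
  show "mat_delete (M x) i j \<in> carrier_mat (N - 1) (N - 1)" for x
    by (rule mat_delete_carrier[OF assms(1)])
  fix r c assume rc: "r < N - 1" "c < N - 1"
  have "mat_delete (M x) i j $$ (r, c) =
    M x $$ (if r < i then r else Suc r, if c < j then c else Suc c)" for x
    using rc assms(1)[of x] by (simp add: mat_delete_def)
  with rc show "poly_fun n d (\<lambda>x. mat_delete (M x) i j $$ (r, c))"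
    by (auto intro: assms(4))
qed

lemma poly_fun_sylvester:
  assumes "\<And>i. poly_fun n d (a i)" "\<And>i. poly_fun n d (b i)" "r < e + k" "c < e + k"
  shows "poly_fun n d (\<lambda>x. sylvester k e (\<lambda>i. a i x) (\<lambda>i. b i x) $$ (r, c))"
  using assms by (cases "r < e"; cases "r \<le> c"; cases "c \<le> r + k"; cases "r - e \<le> c"; cases "c \<le> r")
    (auto simp: sylvester_def intro: poly_fun.const)

section \<open>Elimination\<close>

text \<open>Closure under multiplication concerns only functions of the first \<open>n\<close>
  variables, so one set can serve as an ideal for different \<open>n\<close>. Elimination ideals
  then arise by lowering \<open>n\<close>.\<close>

definition fun_ideal :: "nat \<Rightarrow> ((nat \<Rightarrow> 'a::comm_ring_1) \<Rightarrow> 'a) set \<Rightarrow> bool" where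
  "fun_ideal n I \<longleftrightarrow> (\<lambda>x. 0) \<in> I \<and> (\<forall>f\<in>I. \<forall>g\<in>I. (\<lambda>x. f x + g x) \<in> I) \<and>
     (\<forall>f\<in>I. \<forall>h d. poly_fun n d h \<longrightarrow> (\<lambda>x. h x * f x) \<in> I)"

lemma fun_idealD:
  assumes "fun_ideal n I"
  shows "(\<lambda>x. 0) \<in> I"
    and "f \<in> I \<Longrightarrow> g \<in> I \<Longrightarrow> (\<lambda>x. f x + g x) \<in> I"
    and "f \<in> I \<Longrightarrow> poly_fun n d h \<Longrightarrow> (\<lambda>x. h x * f x) \<in> I"
  using assms unfolding fun_ideal_def by blast+

text \<open>Each point of \<open>A\<close> excludes at most one value of the scalar
  \<open>c\<close>, and the field is infinite. In the elimination step this replaces infinitely many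
  functions by a single one, so that one resultant suffices.\<close>

lemma exists_nonvanishing_combination:
  fixes G :: "('p \<Rightarrow> 'a::field) set"
  assumes "infinite (UNIV :: 'a set)" "finite A" "G \<noteq> {}"
    and "\<And>g h c. g \<in> G \<Longrightarrow> h \<in> G \<Longrightarrow> (\<lambda>x. g x + c * h x) \<in> G"
    and "\<And>r. r \<in> A \<Longrightarrow> \<exists>g\<in>G. g r \<noteq> 0"
  shows "\<exists>g\<in>G. \<forall>r\<in>A. g r \<noteq> 0"
  using assms(2,5)
proof (induction A rule: finite_induct)
  case empty
  then show ?case using assms(3) by auto
next
  case (insert r A)
  then obtain g h where g: "g \<in> G" "\<forall>r\<in>A. g r \<noteq> 0" and h: "h \<in> G" "h r \<noteq> 0"
    by (meson insertI1 insertI2)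
  have "finite ((\<lambda>s. - g s / h s) ` insert r A \<union> {0})" using insert by auto
  then obtain c where c: "c \<notin> (\<lambda>s. - g s / h s) ` insert r A \<union> {0}"
    using ex_new_if_finite[OF assms(1)] by blast
  have "g s + c * h s \<noteq> 0" if "s \<in> insert r A" for s
  proof
    assume 0: "g s + c * h s = 0"
    show False
    proof (cases "h s = 0")
      case True
      with 0 g(2) h(2) that show False by auto
    next
      case False
      with 0 have "c = - g s / h s" by (simp add: field_simps eq_neg_iff_add_eq_0)
      with c that show False by blast
    qed
  qed
  with assms(4)[OF g(1) h(1)] show ?case by (intro bexI[of _ "\<lambda>x. g x + c * h x"]) simp_all
qed

lemma finite_sum_roots:
  fixes a :: "nat \<Rightarrow> 'a::idom"
  assumes "a j \<noteq> 0" "j \<le> k"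
  shows "finite {t. (\<Sum>i\<le>k. a i * t ^ i) = 0}"
proof -
  define p where "p = (\<Sum>i\<le>k. monom (a i) i)"
  have "coeff p j = a j" using assms(2) by (simp add: p_def coeff_sum)
  then have "p \<noteq> 0" using assms(1) by auto
  moreover have "poly p t = (\<Sum>i\<le>k. a i * t ^ i)" for t
    by (simp add: p_def poly_sum poly_monom)
  ultimately show ?thesis using poly_roots_finite[of p] by simp
qed

text \<open>The summand \<open>d\<close> counts the roots of a leading coefficient, a polynomial in
  \<open>x 0\<close> of degree at most \<open>d\<close>. The new degree \<open>2 * d * d\<close>
  bounds a Sylvester determinant of size at most \<open>2 * d\<close> with entries of degree at most
  \<open>d\<close>.\<close>

primrec elim_bound :: "nat \<Rightarrow> nat \<Rightarrow> nat" where
  "elim_bound 0 d = 0"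
| "elim_bound (Suc m) d = d + elim_bound m (2 * d * d)"

text \<open>The extra \<open>d\<close> on the left makes the induction close: it absorbs the summand
  of the recursion, and \<open>2 * (2 * d * d)\<close> is the square of
  \<open>2 * d\<close>.\<close>

lemma elim_bound_le:
  assumes "d > 0"
  shows "elim_bound m d + d \<le> (2 * d) ^ 2 ^ m"
  using assms
proof (induction m arbitrary: d)
  case (Suc m)
  have "elim_bound (Suc m) d + d = elim_bound m (2 * d * d) + 2 * d" by simp
  also have "\<dots> \<le> elim_bound m (2 * d * d) + 2 * d * d"
    using Suc.prems by (cases d) auto
  also have "\<dots> \<le> (2 * (2 * d * d)) ^ 2 ^ m"
    by (rule Suc.IH) (use Suc.prems in simp)
  also have "2 * (2 * d * d) = (2 * d) ^ 2" by (simp add: power2_eq_square)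
  finally show ?case by (simp only: power_mult[symmetric] power_Suc)
qed simp

section \<open>Linear changes of variables and leading coefficients\<close>

definition unshear :: "nat \<Rightarrow> (nat \<Rightarrow> 'a::field) \<Rightarrow> (nat \<Rightarrow> 'a) \<Rightarrow> nat \<Rightarrow> 'a" where
  "unshear m v x i =
     (if i = 0 \<or> i > m then x i else if i = m then x m / v m else x i - v i * (x m / v m))"

lemma shear_unshear: "m > 0 \<Longrightarrow> v m \<noteq> 0 \<Longrightarrow> shear m v (unshear m v x) = x"
  by (rule ext) (auto simp: shear_def unshear_def)

lemma poly_fun_shear:
  assumes "i < Suc m"
  shows "poly_fun (Suc m) 1 (\<lambda>x. shear m v x i)"
proof -
  have var: "poly_fun (Suc m) 1 (\<lambda>x :: nat \<Rightarrow> 'a. x k)" if "k \<le> m" for k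
    using poly_fun_var[of k "Suc m" 0] that by simp
  consider "i = 0" | "i = m" "i \<noteq> 0" | "0 < i" "i < m" using assms by linarith
  then show ?thesis
  proof cases
    case 1
    then show ?thesis using var[of 0] by (simp add: shear_def)
  next
    case 2
    then show ?thesis using poly_fun_cmult[OF var[of m], of "v m"] by (simp add: shear_def)
  next
    case 3
    then show ?thesis using poly_fun.add[OF var[of i] poly_fun_cmult[OF var[of m], of "v i"]]
      by (simp add: shear_def)
  qed
qed

lemma poly_fun_unshear:
  assumes "i < Suc m"
  shows "poly_fun (Suc m) 1 (\<lambda>x. unshear m v x i)"
proof -
  have var: "poly_fun (Suc m) 1 (\<lambda>x :: nat \<Rightarrow> 'a. x k)" if "k \<le> m" for k
    using poly_fun_var[of k "Suc m" 0] that by simp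
  consider "i = 0" | "i = m" "i \<noteq> 0" | "0 < i" "i < m" using assms by linarith
  then show ?thesis
  proof cases
    case 1
    then show ?thesis using var[of 0] by (simp add: unshear_def)
  next
    case 2
    then show ?thesis using poly_fun_cmult[OF var[of m], of "1 / v m"] by (simp add: unshear_def)
  next
    case 3
    then show ?thesis
      using poly_fun_diff[OF var[of i] poly_fun_cmult[OF var[of m], of "v i / v m"]]
      by (simp add: unshear_def)
  qed
qed

lemma poly_fun_first_var:
  fixes f :: "(nat \<Rightarrow> 'a::comm_ring_1) \<Rightarrow> 'a"
  assumes "poly_fun n d f" "\<And>x. f x = f (\<lambda>i. if i = 0 then x 0 else 0)" "f z \<noteq> 0"
  shows "\<exists>q. q \<noteq> 0 \<and> f = (\<lambda>x. poly q (x 0))"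
proof -
  obtain q where "\<forall>t. poly q t = f (\<lambda>i. poly (if i = 0 then [:0, 1:] else 0) t)"
    using poly_fun_univariate[OF assms(1), of "\<lambda>i. if i = 0 then [:0, 1:] else 0"] by blast
  then have "poly q t = f (\<lambda>i. if i = 0 then t else 0)" for t
    by (auto intro!: arg_cong[where f = f])
  then have "f = (\<lambda>x. poly q (x 0))" using assms(2) by (intro ext) auto
  with assms(3) show ?thesis by (intro exI[of _ q]) auto
qed

text \<open>A homogeneous part of degree \<open>j < k\<close> yields only powers of
  \<open>x m\<close> up to \<open>j\<close>, so the coefficient of \<open>x m ^ k\<close> comes from
  the part of degree \<open>k\<close> alone.\<close>

lemma hom_parts_shear:
  fixes h :: "nat \<Rightarrow> (nat \<Rightarrow> 'a::comm_ring_1) \<Rightarrow> 'a"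
  assumes "\<And>j. hom_fun m j d (h j)" "m > 0"
  shows "\<exists>a. (\<forall>i. poly_fun m d (a i)) \<and>
    (\<forall>x. (\<Sum>j\<le>k. h j (shear m v x)) = (\<Sum>i\<le>k. a i x * x m ^ i)) \<and>
    (\<forall>x. a k x = h k (\<lambda>i. if i = 0 then x 0 else v i))"
proof -
  define w where "w = (\<lambda>j (x :: nat \<Rightarrow> 'a). h j (\<lambda>i. if i = 0 then x 0 else v i))"
  have w: "poly_fun m d (w j)" for j
    unfolding w_def using hom_fun_poly_fun[OF assms(1)[of j]]
  proof (rule poly_fun_subst)
    fix i assume "i < Suc m"
    show "poly_fun m 1 (\<lambda>x. if i = 0 then x 0 else v i)"
      using \<open>m > 0\<close> poly_fun_var[of 0 m 0, where 'a = 'a] by (cases "i = 0") (auto intro: poly_fun.const)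
  qed
  have "\<forall>j. \<exists>a. (\<forall>i. poly_fun m d (a i)) \<and>
    (\<forall>x. h j (shear m v x) = (\<Sum>i<j. a i x * x m ^ i) + w j x * x m ^ j)"
    using hom_fun_shear[OF assms(1) assms(2)] unfolding w_def by blast
  then obtain a where a: "\<And>i j. poly_fun m d (a j i)"
    "\<And>j x. h j (shear m v x) = (\<Sum>i<j. a j i x * x m ^ i) + w j x * x m ^ j"
    by metis
  define b where "b = (\<lambda>j i x. if i < j then a j i x else if i = j then w j x else 0)"
  have b: "poly_fun m d (b j i)" for i j
    using w a(1) by (cases "i < j"; cases "i = j") (auto simp: b_def intro: poly_fun.const)
  have "h j (shear m v x) = (\<Sum>i\<le>k. b j i x * x m ^ i)" if "j \<le> k" for j x
  proof -
    have "h j (shear m v x) = (\<Sum>i\<le>j. b j i x * x m ^ i)"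
      by (simp add: a(2) b_def lessThan_Suc_atMost[symmetric])
    also have "\<dots> = (\<Sum>i\<le>k. b j i x * x m ^ i)"
      using that by (intro sum.mono_neutral_left) (auto simp: b_def)
    finally show ?thesis .
  qed
  then have "(\<Sum>j\<le>k. h j (shear m v x)) = (\<Sum>j\<le>k. \<Sum>i\<le>k. b j i x * x m ^ i)" for x
    by simp
  also have "(\<Sum>j\<le>k. \<Sum>i\<le>k. b j i x * x m ^ i) = (\<Sum>i\<le>k. (\<Sum>j\<le>k. b j i x) * x m ^ i)" for x
    by (subst sum.swap) (simp add: sum_distrib_right)
  moreover have "(\<Sum>j\<le>k. b j k x) = w k x" for x
    by (subst sum.remove[of _ k]) (auto simp: b_def intro!: sum.neutral)
  ultimately show ?thesis
    using b by (intro exI[of _ "\<lambda>i x. \<Sum>j\<le>k. b j i x"]) (auto intro: poly_fun_sum simp: w_def)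
qed

text \<open>The vector \<open>v\<close> serves as the direction of a shear, which is invertible only
  for \<open>v m\<close> different from 0. Along the line through \<open>x\<close> in the last
  coordinate just finitely many points are bad.\<close>

lemma poly_fun_nonzero_at_nonzero_last:
  fixes f :: "(nat \<Rightarrow> 'a::idom) \<Rightarrow> 'a"
  assumes "infinite (UNIV :: 'a set)" "poly_fun (Suc m) d f" "f x \<noteq> 0"
  shows "\<exists>v. f v \<noteq> 0 \<and> v m \<noteq> 0"
proof -
  obtain a where a: "\<And>i. poly_fun m d (a i)" "\<And>x. f x = (\<Sum>i\<le>d. a i x * x m ^ i)"
    using poly_fun_last_var[OF assms(2)] by blast
  have "f x = 0" if "\<forall>j\<le>d. a j x = 0"
    unfolding a(2) using that by (intro sum.neutral) auto
  with assms(3) obtain j where "j \<le> d" "a j x \<noteq> 0" by blast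
  then have "finite ({t. (\<Sum>i\<le>d. a i x * t ^ i) = 0} \<union> {0})"
    using finite_sum_roots[of "\<lambda>i. a i x" j d] by simp
  then obtain t where t: "(\<Sum>i\<le>d. a i x * t ^ i) \<noteq> 0" "t \<noteq> 0"
    using ex_new_if_finite[OF assms(1), of "{t. (\<Sum>i\<le>d. a i x * t ^ i) = 0} \<union> {0}"] by auto
  have "a i (x(m := t)) = a i x" for i
    by (rule poly_fun_cong[OF a(1)]) auto
  with t have "f (x(m := t)) \<noteq> 0" unfolding a(2) by simp
  with t(2) show ?thesis by (intro exI[of _ "x(m := t)"]) auto
qed

text \<open>Classical elimination: after a linear change of variables the last variable is removed by
  resultants of one element of \<open>I\<close> with all others. The exceptional values are the roots of the
  leading coefficients that occur.\<close>

lemma elimination: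
  fixes I :: "((nat \<Rightarrow> 'a::alg_closed_field) \<Rightarrow> 'a) set"
  assumes "fun_ideal (Suc m) I"
  shows "(\<exists>q. q \<noteq> 0 \<and> (\<lambda>x. poly q (x 0)) \<in> I) \<or>
    (\<exists>E. finite E \<and> card E \<le> elim_bound m d \<and>
      (\<forall>c. c \<notin> E \<longrightarrow> (\<exists>x. x 0 = c \<and> (\<forall>f\<in>I. poly_fun (Suc m) d f \<longrightarrow> f x = 0))))"
  using assms
proof (induction m arbitrary: I d)
  case (0 I)
  show ?case
  proof (cases "\<forall>f\<in>I. poly_fun (Suc 0) d f \<longrightarrow> (\<forall>x. f x = 0)")
    case True
    then show ?thesis by (intro disjI2 exI[of _ "{}"]) (auto intro!: exI[of _ "\<lambda>i. c" for c])
  next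
    case False
    then obtain f z where f: "f \<in> I" "poly_fun (Suc 0) d f" "f z \<noteq> 0" by blast
    have "f x = f (\<lambda>i. if i = 0 then x 0 else 0)" for x
      by (rule poly_fun_cong[OF f(2)]) auto
    from poly_fun_first_var[OF f(2) this f(3)] f(1) show ?thesis by blast
  qed
next
  case (Suc m I)
  define M where "M = Suc m"
  have "M > 0" by (simp add: M_def)
  note I = fun_idealD[OF Suc.prems, folded M_def]
  show ?case
  proof (cases "\<forall>f\<in>I. poly_fun (Suc M) d f \<longrightarrow> (\<forall>x. f x = 0)")
    case True
    then show ?thesis unfolding M_def
      by (intro disjI2 exI[of _ "{}"]) (auto intro!: exI[of _ "\<lambda>i. c" for c])
  next
    case False
    then obtain f z where f: "f \<in> I" "poly_fun (Suc M) d f" "f z \<noteq> 0" by blast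
    obtain h where h: "\<And>j. hom_fun M j d (h j)" "\<And>x. f x = (\<Sum>j\<le>d. h j x)"
      using poly_fun_hom_parts[OF f(2)] by blast
    \<comment> \<open>The degree is taken in \<open>x 1, ..., x M\<close> only. If it is 0, then
      \<open>f\<close> is a nonzero polynomial in \<open>x 0\<close>, which is the first
      alternative.\<close>
    define k where "k = Max {j. j \<le> d \<and> (\<exists>x. h j x \<noteq> 0)}"
    have fin: "finite {j. j \<le> d \<and> (\<exists>x. h j x \<noteq> 0)}" by simp
    have "f z = 0" if "\<forall>j\<le>d. h j z = 0"
      unfolding h(2) using that by (intro sum.neutral) auto
    with f(3) have ne: "{j. j \<le> d \<and> (\<exists>x. h j x \<noteq> 0)} \<noteq> {}" by blast
    from Max_in[OF fin ne] obtain z' where k: "k \<le> d" "h k z' \<noteq> 0" by (auto simp: k_def)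
    have above: "h j x = 0" if "k < j" "j \<le> d" for j x
      using Max_ge[OF fin, of j] that unfolding k_def by (metis (mono_tags, lifting) mem_Collect_eq not_less)
    have fk: "f x = (\<Sum>j\<le>k. h j x)" for x
      unfolding h(2) using k(1) above by (intro sum.mono_neutral_right) auto
    show ?thesis
    proof (cases "k = 0")
      case True
      have "f x = f (\<lambda>i. if i = 0 then x 0 else 0)" for x
        using hom_fun_0[OF h(1)[of 0]] by (simp add: fk True)
      from poly_fun_first_var[OF f(2) this f(3)] f(1) show ?thesis by blast
    next
      case False
      obtain v where v: "h k v \<noteq> 0" "v M \<noteq> 0"
        using poly_fun_nonzero_at_nonzero_last[OF infinite_UNIV_alg_closed hom_fun_poly_fun[OF h(1)] k(2)]
        by blast
      define \<Phi> where "\<Phi> = shear M v"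
      define \<Psi> where "\<Psi> = unshear M v"
      have \<Phi>\<Psi>: "\<Phi> (\<Psi> x) = x" for x
        unfolding \<Phi>_def \<Psi>_def using \<open>M > 0\<close> v(2) by (intro shear_unshear)
      have \<Phi>0: "\<Phi> x 0 = x 0" and \<Psi>0: "\<Psi> x 0 = x 0" for x
        by (simp_all add: \<Phi>_def shear_def \<Psi>_def unshear_def)
      have comp_\<Psi>: "poly_fun (Suc M) e (\<lambda>x. g (\<Psi> x))" if "poly_fun (Suc M) e g" for e g
        using poly_fun_subst[OF that poly_fun_unshear[of _ M v]] unfolding \<Psi>_def .
      have comp_\<Phi>: "poly_fun (Suc M) e (\<lambda>x. g (\<Phi> x))" if "poly_fun (Suc M) e g" for e g
        using poly_fun_subst[OF that poly_fun_shear[of _ M v]] unfolding \<Phi>_def .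
      obtain a where a: "\<And>i. poly_fun M d (a i)" "\<And>x. f (\<Phi> x) = (\<Sum>i\<le>k. a i x * x M ^ i)"
        "\<And>x. a k x = h k (\<lambda>i. if i = 0 then x 0 else v i)"
        using hom_parts_shear[OF h(1) \<open>M > 0\<close>, of v k] unfolding fk \<Phi>_def by blast
      obtain w where w: "degree w \<le> d" "\<And>t. poly w t = h k (\<lambda>i. if i = 0 then t else v i)"
      proof -
        obtain q where q: "\<forall>t. poly q t = h k (\<lambda>i. poly (if i = 0 then [:0, 1:] else [:v i:]) t)"
          "(\<forall>i<Suc M. degree (if i = 0 then [:0, 1:] else [:v i:]) \<le> 1) \<longrightarrow> degree q \<le> d"
          using poly_fun_univariate[OF hom_fun_poly_fun[OF h(1)[of k]],
              of "\<lambda>i. if i = 0 then [:0, 1:] else [:v i:]"] by blast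
        have "poly q t = h k (\<lambda>i. if i = 0 then t else v i)" for t
          unfolding q(1)[rule_format] by (intro arg_cong[where f = "h k"]) auto
        with q(2) show ?thesis by (intro that) auto
      qed
      have "poly w (v 0) = h k v" unfolding w(2) by (intro arg_cong[where f = "h k"]) auto
      with v(1) have "w \<noteq> 0" by auto
      \<comment> \<open>In the new coordinates \<open>J\<close> is the whole transformed ideal. The
        induction hypothesis looks only at its members in the first \<open>M\<close> variables,
        which form the elimination ideal.\<close>
      define J where "J = {g. (\<lambda>x. g (\<Psi> x)) \<in> I}"
      have "fun_ideal M J"
        unfolding fun_ideal_def J_def mem_Collect_eq
      proof (intro conjI ballI allI impI)
        fix f h :: "(nat \<Rightarrow> 'a) \<Rightarrow> 'a" and e assume "f \<in> {g. (\<lambda>x. g (\<Psi> x)) \<in> I}" "poly_fun M e h"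
        moreover from this(2) have "poly_fun (Suc M) e (\<lambda>x. h (\<Psi> x))"
          by (rule comp_\<Psi>[OF poly_fun_mono]) auto
        ultimately show "(\<lambda>x. h (\<Psi> x) * f (\<Psi> x)) \<in> I" using I(3) by auto
      qed (use I(1,2) in auto)
      from Suc.IH[OF this[unfolded M_def], of "2 * d * d"]
      consider q where "q \<noteq> 0" "(\<lambda>x. poly q (x 0)) \<in> J"
        | E where "finite E" "card E \<le> elim_bound m (2 * d * d)"
          "\<And>c. c \<notin> E \<Longrightarrow> \<exists>x. x 0 = c \<and> (\<forall>f\<in>J. poly_fun M (2 * d * d) f \<longrightarrow> f x = 0)"
        unfolding M_def by blast
      then show ?thesis
      proof cases
        case 1
        then show ?thesis unfolding J_def by (auto simp: \<Psi>0)
      next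
        case (2 E)
        define E' where "E' = E \<union> {t. poly w t = 0}"
        have "finite E'" using 2(1) poly_roots_finite[OF \<open>w \<noteq> 0\<close>] by (simp add: E'_def)
        moreover have "card E' \<le> elim_bound (Suc m) d"
          using card_Un_le[of E "{t. poly w t = 0}"] 2(2) w(1) card_poly_roots_bound[OF \<open>w \<noteq> 0\<close>]
          by (simp add: E'_def)
        moreover have "\<exists>x. x 0 = c \<and> (\<forall>g\<in>I. poly_fun (Suc M) d g \<longrightarrow> g x = 0)" if "c \<notin> E'" for c
        proof -
          from that 2(3)[of c] obtain y where y: "y 0 = c"
            "\<And>g. g \<in> J \<Longrightarrow> poly_fun M (2 * d * d) g \<Longrightarrow> g y = 0"
            unfolding E'_def by blast
          have ak: "a k y \<noteq> 0" using that y(1) unfolding a(3) w(2)[symmetric] by (auto simp: E'_def)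
          define G where "G = {g \<in> I. poly_fun (Suc M) d g}"
          define Z where "Z = {t. (\<Sum>i\<le>k. a i y * t ^ i) = 0}"
          define P where "P = (\<lambda>t. \<Phi> (y(M := t)))"
          have "finite Z" unfolding Z_def using finite_sum_roots[of "\<lambda>i. a i y" k k] ak by simp
          \<comment> \<open>The partial zero \<open>y\<close> extends to one of the finitely many
            roots in \<open>Z\<close>. If each root were excluded by some member of
            \<open>G\<close>, a single \<open>g\<close> would exclude all of them; the resultant of
            \<open>f\<close> and \<open>g\<close> would then be nonzero at \<open>y\<close>,
            although it belongs to \<open>J\<close> and has degree at most
            \<open>2 * d * d\<close>.\<close>
          have "\<exists>t\<in>Z. \<forall>g\<in>G. g (P t) = 0"
          proof (rule ccontr)
            assume no: "\<not> (\<exists>t\<in>Z. \<forall>g\<in>G. g (P t) = 0)"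
            have "\<exists>g\<in>G. \<forall>r\<in>P ` Z. g r \<noteq> 0"
            proof (rule exists_nonvanishing_combination[OF infinite_UNIV_alg_closed])
              show "G \<noteq> {}" using I(1) poly_fun.const[of "Suc M" d 0] unfolding G_def by blast
              show "(\<lambda>x. g x + c * g' x) \<in> G" if "g \<in> G" "g' \<in> G" for g g' c
                using that I(2)[of g "\<lambda>x. c * g' x"] I(3)[of g' d "\<lambda>x. c"]
                unfolding G_def by (auto intro: poly_fun.intros poly_fun_cmult)
            qed (use no \<open>finite Z\<close> in auto)
            then obtain g where g: "g \<in> I" "poly_fun (Suc M) d g" "\<And>t. t \<in> Z \<Longrightarrow> g (P t) \<noteq> 0"
              unfolding G_def by blast
            obtain b where b: "\<And>i. poly_fun M d (b i)" "\<And>x. g (\<Phi> x) = (\<Sum>i\<le>d. b i x * x M ^ i)"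
              using poly_fun_last_var[OF comp_\<Phi>[OF g(2)]] by blast
            define S where "S = (\<lambda>x. sylvester k d (\<lambda>i. a i x) (\<lambda>i. b i x))"
            have S: "S x \<in> carrier_mat (d + k) (d + k)" for x
              unfolding S_def by (rule sylvester_carrier)
            have Sij: "poly_fun M d (\<lambda>x. S x $$ (r, c))" if "r < d + k" "c < d + k" for r c
              unfolding S_def by (rule poly_fun_sylvester[OF a(1) b(1) that])
            have "poly_fun M ((d + k) * d) (\<lambda>x. det (S x))"
              by (rule poly_fun_det[OF S Sij])
            then have deg: "poly_fun M (2 * d * d) (\<lambda>x. det (S x))"
              using mult_le_mono1[of "d + k" "2 * d" d] k(1) by (auto elim!: poly_fun_mono)
            define C where "C = (\<lambda>x. \<Sum>r<d. cofactor (S x) r 0 * x M ^ r)"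
            define D where "D = (\<lambda>x. \<Sum>j<k. cofactor (S x) (d + j) 0 * x M ^ j)"
            have cof: "poly_fun (Suc M) ((d + k - 1) * d + (d + k)) (\<lambda>x. cofactor (S x) r 0 * x M ^ i)"
              if "r < d + k" "i < d + k" for r i
            proof (rule poly_fun_mult)
              have "poly_fun M ((d + k - 1) * d) (\<lambda>x. cofactor (S x) r 0)"
                using that(1) by (intro poly_fun_cofactor[OF S _ _ Sij]) auto
              then show "poly_fun (Suc M) ((d + k - 1) * d) (\<lambda>x. cofactor (S x) r 0)"
                by (rule poly_fun_mono) auto
              have "poly_fun (Suc M) (i * 1) (\<lambda>x :: nat \<Rightarrow> 'a. x M ^ i)"
                using poly_fun_var[of M "Suc M" 0, where 'a = 'a] by (intro poly_fun_power) simp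
              then show "poly_fun (Suc M) (d + k) (\<lambda>x :: nat \<Rightarrow> 'a. x M ^ i)"
                using that(2) by (auto elim!: poly_fun_mono)
            qed
            have CD: "poly_fun (Suc M) ((d + k - 1) * d + (d + k)) C"
              "poly_fun (Suc M) ((d + k - 1) * d + (d + k)) D"
              unfolding C_def D_def using cof by (auto intro!: poly_fun_sum)
            have "det (S (\<Psi> x)) = C (\<Psi> x) * f x + D (\<Psi> x) * g x" for x
              using det_sylvester_combination[of d k "\<lambda>i. a i (\<Psi> x)" "\<lambda>i. b i (\<Psi> x)" "\<Psi> x M"] False
              unfolding a(2)[of "\<Psi> x", symmetric] b(2)[of "\<Psi> x", symmetric] \<Phi>\<Psi> C_def D_def S_def
              by simp
            then have "(\<lambda>x. det (S (\<Psi> x))) \<in> I"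
              using I(2)[OF I(3)[OF f(1) comp_\<Psi>[OF CD(1)]] I(3)[OF g(1) comp_\<Psi>[OF CD(2)]]] by simp
            then have "det (S y) = 0" using y(2)[OF _ deg] unfolding J_def by simp
            moreover have "det (S y) \<noteq> 0"
              unfolding S_def
            proof (rule det_sylvester_nonzero)
              show "a k y \<noteq> 0" by (rule ak)
            next
              fix t assume "(\<Sum>i\<le>k. a i y * t ^ i) = 0"
              then have "g (P t) \<noteq> 0" by (intro g(3)) (simp add: Z_def)
              moreover have "b i (y(M := t)) = b i y" for i
                by (rule poly_fun_cong[OF b(1)]) auto
              ultimately show "(\<Sum>i\<le>d. b i y * t ^ i) \<noteq> 0" unfolding P_def b(2) by simp
            qed
            ultimately show False by simp
          qed
          then obtain t where "\<forall>g\<in>G. g (P t) = 0" by blast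
          moreover have "P t 0 = c" using \<open>M > 0\<close> y(1) by (simp add: P_def \<Phi>0)
          ultimately show ?thesis unfolding G_def by blast
        qed
        ultimately show ?thesis unfolding M_def by blast
      qed
    qed
  qed
qed

section \<open>Powers of ideals generated by quadrics\<close>

definition exponents :: "nat \<Rightarrow> nat \<Rightarrow> (nat \<Rightarrow> nat) set" where
  "exponents n d = {a. (\<forall>i\<ge>n. a i = 0) \<and> (\<Sum>i<n. a i) \<le> d}"

definition monom_fun :: "nat \<Rightarrow> (nat \<Rightarrow> nat) \<Rightarrow> (nat \<Rightarrow> 'a::comm_ring_1) \<Rightarrow> 'a" where
  "monom_fun n a x = (\<Prod>i<n. x i ^ a i)"

lemma exponents_le: "a \<in> exponents n d \<Longrightarrow> i < n \<Longrightarrow> a i \<le> d"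
  using member_le_sum[of i "{..<n}" a] by (auto simp: exponents_def)

lemma inj_on_restrict_exponents: "inj_on (\<lambda>a. restrict a {..<n}) (exponents n d)"
proof (rule inj_onI, rule ext)
  fix a b i assume *: "a \<in> exponents n d" "b \<in> exponents n d" "restrict a {..<n} = restrict b {..<n}"
  show "a i = b i"
    using *(1,2) fun_cong[OF *(3), of i] by (cases "i < n") (simp_all add: exponents_def)
qed

lemma finite_exponents: "finite (exponents n d)"
proof (rule finite_imageD[OF _ inj_on_restrict_exponents])
  have "(\<lambda>a. restrict a {..<n}) ` exponents n d \<subseteq> PiE {..<n} (\<lambda>_. {..d})"
    by (auto simp: PiE_iff extensional_def dest: exponents_le split: if_splits)
  then show "finite ((\<lambda>a. restrict a {..<n}) ` exponents n d)"
    by (rule finite_subset) (auto intro!: finite_PiE)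
qed

text \<open>Division by 3 with remainder in every coordinate: there are \<open>3 ^ n\<close>
  remainder vectors, and the quotient vector has total degree at most \<open>d\<close>. The base 3
  of the bound on the number of zeros originates here.\<close>

lemma card_exponents_triple: "card (exponents n (3 * d)) \<le> 3 ^ n * card (exponents n d)"
proof -
  define \<phi> where "\<phi> = (\<lambda>a :: nat \<Rightarrow> nat. (restrict (\<lambda>i. a i mod 3) {..<n}, \<lambda>i. a i div 3))"
  have "inj_on \<phi> (exponents n (3 * d))"
  proof (rule inj_onI, rule ext)
    fix a b i assume *: "a \<in> exponents n (3 * d)" "b \<in> exponents n (3 * d)" "\<phi> a = \<phi> b"
    have "snd (\<phi> a) i = snd (\<phi> b) i" "fst (\<phi> a) i = fst (\<phi> b) i" using *(3) by simp_all
    then have "a i div 3 = b i div 3" "i < n \<Longrightarrow> a i mod 3 = b i mod 3"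
      by (simp_all add: \<phi>_def)
    moreover have "a i mod 3 = b i mod 3"
      using calculation *(1,2) by (cases "i < n") (auto simp: exponents_def)
    ultimately show "a i = b i" by (metis div_mult_mod_eq)
  qed
  moreover have "\<phi> ` exponents n (3 * d) \<subseteq> PiE {..<n} (\<lambda>_. {..<3}) \<times> exponents n d"
  proof
    fix z assume "z \<in> \<phi> ` exponents n (3 * d)"
    then obtain a where a: "a \<in> exponents n (3 * d)" "z = \<phi> a" by blast
    have "3 * (\<Sum>i<n. a i div 3) \<le> (\<Sum>i<n. a i)"
      unfolding sum_distrib_left by (intro sum_mono) auto
    with a show "z \<in> PiE {..<n} (\<lambda>_. {..<3}) \<times> exponents n d" by (auto simp: \<phi>_def exponents_def)
  qed
  ultimately have "card (exponents n (3 * d)) \<le> card (PiE {..<n} (\<lambda>_. {..<3::nat}) \<times> exponents n d)"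
    by (intro card_inj_on_le) (auto intro!: finite_PiE finite_exponents)
  also have "\<dots> = 3 ^ n * card (exponents n d)"
    by (simp add: card_cartesian_product card_PiE)
  finally show ?thesis .
qed

lemma poly_fun_monom_fun: "a \<in> exponents n d \<Longrightarrow> poly_fun n d (monom_fun n a)"
proof -
  assume a: "a \<in> exponents n d"
  have "poly_fun n (\<Sum>i<n. a i * 1) (\<lambda>x :: nat \<Rightarrow> 'a. \<Prod>i<n. x i ^ a i)"
    using poly_fun_var[of _ n 0, where 'a = 'a] by (intro poly_fun_prod poly_fun_power) auto
  then have "poly_fun n (\<Sum>i<n. a i) (monom_fun n a :: _ \<Rightarrow> 'a)" by (simp add: monom_fun_def[abs_def])
  then show ?thesis using a by (elim poly_fun_mono) (auto simp: exponents_def)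
qed

lemma poly_fun_eq_sum_monom_fun:
  assumes "poly_fun n d f"
  shows "\<exists>c. \<forall>x. f x = (\<Sum>a\<in>exponents n d. c a * monom_fun n a x)"
  using assms
proof (induction rule: poly_fun.induct)
  case (const d c)
  have "(\<lambda>_. 0) \<in> exponents n d" by (simp add: exponents_def)
  then have "c = (\<Sum>a\<in>exponents n d. (if a = (\<lambda>_. 0) then c else 0) * monom_fun n a x)" for x
    using finite_exponents by (subst sum.remove[of _ "\<lambda>_. 0"]) (auto simp: monom_fun_def)
  then show ?case by (intro exI[of _ "\<lambda>a. if a = (\<lambda>_. 0) then c else 0"] allI)
next
  case (add d f g)
  then obtain b c where "\<forall>x. f x = (\<Sum>a\<in>exponents n d. b a * monom_fun n a x)"
    "\<forall>x. g x = (\<Sum>a\<in>exponents n d. c a * monom_fun n a x)" by blast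
  then show ?case by (intro exI[of _ "\<lambda>a. b a + c a"]) (simp add: distrib_right sum.distrib)
next
  case (var i d f)
  then obtain c where c: "\<And>x. f x = (\<Sum>a\<in>exponents n d. c a * monom_fun n a x)" by blast
  define up where "up = (\<lambda>a :: nat \<Rightarrow> nat. a(i := Suc (a i)))"
  define down where "down = (\<lambda>a :: nat \<Rightarrow> nat. a(i := a i - 1))"
  define c' where "c' = (\<lambda>b. if b i > 0 then c (down b) else 0)"
  have sum_upd: "(\<Sum>j<n. (a(i := k)) j) + a i = (\<Sum>j<n. a j) + k" for a :: "nat \<Rightarrow> nat" and k
    using var(1) sum.remove[of "{..<n}" i "a(i := k)"] sum.remove[of "{..<n}" i a] by simp
  have up: "up a \<in> exponents n (Suc d)" "up a i > 0" "down (up a) = a" if "a \<in> exponents n d" for a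
    using that var(1) sum_upd[of a "Suc (a i)"] by (auto simp: up_def down_def exponents_def)
  have down: "down b \<in> exponents n d" "up (down b) = b" if "b \<in> exponents n (Suc d)" "b i > 0" for b
    using that var(1) sum_upd[of b "b i - 1"] by (auto simp: up_def down_def exponents_def)
  have monom_up: "monom_fun n (up a) x = x i * monom_fun n a x" for a and x :: "nat \<Rightarrow> 'a"
    using var(1) unfolding monom_fun_def up_def
    by (subst (1 2) prod.remove[of _ i]) (auto intro!: prod.cong simp: mult.assoc)
  have "(\<Sum>b\<in>exponents n (Suc d). c' b * monom_fun n b x) = x i * f x" for x
  proof -
    have "(\<Sum>b\<in>exponents n (Suc d). c' b * monom_fun n b x) = (\<Sum>b\<in>{b\<in>exponents n (Suc d). b i > 0}. c' b * monom_fun n b x)"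
      by (intro sum.mono_neutral_right finite_exponents) (auto simp: c'_def)
    also have "\<dots> = (\<Sum>a\<in>exponents n d. c' (up a) * monom_fun n (up a) x)"
      by (rule sum.reindex_bij_witness[of _ up down]) (auto simp: up down)
    also have "\<dots> = (\<Sum>a\<in>exponents n d. x i * (c a * monom_fun n a x))"
      using up by (intro sum.cong) (auto simp: c'_def monom_up mult_ac)
    finally show ?thesis by (simp add: c sum_distrib_left)
  qed
  then show ?case by metis
qed

text \<open>A homogeneous system with more unknowns than equations; one pivot is eliminated for each
  equation.\<close>

lemma linear_relation_exists:
  fixes M :: "'b \<Rightarrow> 'c \<Rightarrow> 'a::field"
  assumes "finite B" "finite A" "card B < card A"
  shows "\<exists>l. (\<exists>a\<in>A. l a \<noteq> 0) \<and> (\<forall>b\<in>B. (\<Sum>a\<in>A. l a * M a b) = 0)"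
  using assms
proof (induction B arbitrary: A M rule: finite_induct)
  case empty
  then obtain a where "a \<in> A" by fastforce
  then show ?case by (intro exI[of _ "\<lambda>_. 1"]) auto
next
  case (insert b B)
  show ?case
  proof (cases "\<forall>a\<in>A. M a b = 0")
    case True
    moreover obtain l where "\<exists>a\<in>A. l a \<noteq> 0" "\<forall>b\<in>B. (\<Sum>a\<in>A. l a * M a b) = 0"
      using insert.IH[of A M] insert by (metis Suc_lessD card_insert_disjoint)
    ultimately show ?thesis by (intro exI[of _ l]) auto
  next
    case False
    then obtain p where p: "p \<in> A" "M p b \<noteq> 0" by blast
    define M' where "M' = (\<lambda>a c. M a c - M a b / M p b * M p c)"
    have "card B < card (A - {p})" using insert p by simp
    then obtain l where l: "\<exists>a\<in>A - {p}. l a \<noteq> 0"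
      "\<And>c. c \<in> B \<Longrightarrow> (\<Sum>a\<in>A - {p}. l a * M' a c) = 0"
      using insert.IH[of "A - {p}" M'] insert.prems(1) by blast
    \<comment> \<open>The value at the pivot is the one that solves the equation
      \<open>b\<close>.\<close>
    define l' where "l' = l(p := - (\<Sum>a\<in>A - {p}. l a * M a b) / M p b)"
    have split: "(\<Sum>a\<in>A. l' a * M a c) =
      (\<Sum>a\<in>A - {p}. l a * M a c) - (\<Sum>a\<in>A - {p}. l a * M a b) / M p b * M p c" for c
    proof -
      have "(\<Sum>a\<in>A. l' a * M a c) = l' p * M p c + (\<Sum>a\<in>A - {p}. l' a * M a c)"
        using insert p by (subst sum.remove[of _ p]) auto
      also have "(\<Sum>a\<in>A - {p}. l' a * M a c) = (\<Sum>a\<in>A - {p}. l a * M a c)"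
        by (intro sum.cong) (auto simp: l'_def)
      finally show ?thesis by (simp add: l'_def)
    qed
    have "(\<Sum>a\<in>A. l' a * M a c) = 0" if "c \<in> insert b B" for c
    proof (cases "c = b")
      case True
      then show ?thesis using p split[of b] by simp
    next
      case False
      with that have "c \<in> B" by simp
      from l(2)[OF this] show ?thesis
        unfolding split M'_def
        by (simp add: right_diff_distrib sum_subtractf sum_divide_distrib sum_distrib_left mult_ac)
    qed
    moreover have "\<exists>a\<in>A. l' a \<noteq> 0" using l(1) by (auto simp: l'_def)
    ultimately show ?thesis by blast
  qed
qed

section \<open>Reduction modulo powers of an ideal\<close>

inductive ideal_pow :: "nat \<Rightarrow> ((nat \<Rightarrow> 'a::comm_ring_1) \<Rightarrow> 'a) set \<Rightarrow> nat \<Rightarrow> ((nat \<Rightarrow> 'a) \<Rightarrow> 'a) \<Rightarrow> bool"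
  for n F where
  base: "poly_fun n d r \<Longrightarrow> ideal_pow n F 0 r"
| zero: "ideal_pow n F k (\<lambda>x. 0)"
| add: "ideal_pow n F k f \<Longrightarrow> ideal_pow n F k g \<Longrightarrow> ideal_pow n F k (\<lambda>x. f x + g x)"
| mult: "f \<in> F \<Longrightarrow> ideal_pow n F k g \<Longrightarrow> ideal_pow n F (Suc k) (\<lambda>x. f x * g x)"

text \<open>An element of level \<open>k\<close> is a sum of products of \<open>k\<close> generators
  with a polynomial cofactor, introduced at level 0. The factor \<open>h\<close> is passed down to
  that cofactor.\<close>

lemma ideal_pow_times:
  assumes "ideal_pow n F k g" "poly_fun n d h"
  shows "ideal_pow n F k (\<lambda>x. h x * g x)"
  using assms(1)
proof (induction rule: ideal_pow.induct)
  case (base d r)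
  then show ?case by (rule ideal_pow.base[OF poly_fun_mult[OF assms(2)]])
next
  case (mult f k g)
  from ideal_pow.mult[OF mult(1) mult.IH] show ?case by (simp add: mult.left_commute)
qed (auto intro: ideal_pow.intros simp: distrib_left)

lemma fun_ideal_pow: "fun_ideal n {f. ideal_pow n F k f}"
  unfolding fun_ideal_def by (auto intro: ideal_pow.zero ideal_pow.add ideal_pow_times)

lemma ideal_pow_1: "f \<in> F \<Longrightarrow> ideal_pow n F 1 f"
  using ideal_pow.mult[OF _ ideal_pow.base[OF poly_fun.const[of n 0 1]], of f F] by simp

lemma ideal_pow_sum:
  "(\<And>i. i \<in> A \<Longrightarrow> ideal_pow n F k (f i)) \<Longrightarrow> ideal_pow n F k (\<lambda>x. \<Sum>i\<in>A. f i x)"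
  by (induction A rule: infinite_finite_induct) (auto intro: ideal_pow.zero ideal_pow.add)

text \<open>In a product of \<open>k\<close> generators and a cofactor only the cofactor is reduced.
  The error gains one more factor from the ideal, and the \<open>k\<close> quadrics add
  \<open>2 * k\<close> to the degree.\<close>

lemma ideal_pow_reduce_step:
  assumes "ideal_pow n F k f"
    and "\<And>f. f \<in> F \<Longrightarrow> poly_fun n 2 f"
    and "\<And>d f. poly_fun n d f \<Longrightarrow> \<exists>g. poly_fun n e g \<and> ideal_pow n F 1 (\<lambda>x. f x - g x)"
  shows "\<exists>g. poly_fun n (e + 2 * k) g \<and> ideal_pow n F (Suc k) (\<lambda>x. f x - g x)"
  using assms(1)
proof (induction rule: ideal_pow.induct)
  case (base d r)
  then show ?case using assms(3) by simp
next
  case (zero k)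
  then show ?case by (intro exI[of _ "\<lambda>x. 0"]) (auto intro: poly_fun.const ideal_pow.zero)
next
  case (add k f g)
  then obtain f' g' where *: "poly_fun n (e + 2 * k) f'" "ideal_pow n F (Suc k) (\<lambda>x. f x - f' x)"
    "poly_fun n (e + 2 * k) g'" "ideal_pow n F (Suc k) (\<lambda>x. g x - g' x)" by blast
  from ideal_pow.add[OF *(2,4)] have "ideal_pow n F (Suc k) (\<lambda>x. (f x + g x) - (f' x + g' x))"
    by (simp add: algebra_simps)
  with poly_fun.add[OF *(1,3)] show ?case by blast
next
  case (mult f k g)
  then obtain g' where *: "poly_fun n (e + 2 * k) g'" "ideal_pow n F (Suc k) (\<lambda>x. g x - g' x)" by blast
  from ideal_pow.mult[OF mult(1) *(2)]
  have "ideal_pow n F (Suc (Suc k)) (\<lambda>x. f x * g x - f x * g' x)" by (simp add: right_diff_distrib)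
  moreover have "poly_fun n (e + 2 * Suc k) (\<lambda>x. f x * g' x)"
    using poly_fun_mult[OF assms(2)[OF mult(1)] *(1)] by (simp add: add.commute add.left_commute)
  ultimately show ?case by blast
qed

text \<open>Successive approximation: the remainder modulo one power of the ideal is reduced modulo
  the next, and the degrees grow by 2 each time.\<close>

lemma ideal_pow_reduce:
  assumes "poly_fun n d f"
    and "\<And>f. f \<in> F \<Longrightarrow> poly_fun n 2 f"
    and "\<And>d f. poly_fun n d f \<Longrightarrow> \<exists>g. poly_fun n e g \<and> ideal_pow n F 1 (\<lambda>x. f x - g x)"
  shows "\<exists>g. poly_fun n (e + 2 * k) g \<and> ideal_pow n F (Suc k) (\<lambda>x. f x - g x)"
proof (induction k)
  case 0
  then show ?case using assms(3)[OF assms(1)] by simp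
next
  case (Suc k)
  then obtain g where g: "poly_fun n (e + 2 * k) g" "ideal_pow n F (Suc k) (\<lambda>x. f x - g x)" by blast
  have "\<exists>h. poly_fun n (e + 2 * Suc k) h \<and> ideal_pow n F (Suc (Suc k)) (\<lambda>x. (f x - g x) - h x)"
    by (rule ideal_pow_reduce_step[OF g(2)]) (use assms(2,3) in auto)
  then obtain h where h: "poly_fun n (e + 2 * Suc k) h"
    "ideal_pow n F (Suc (Suc k)) (\<lambda>x. (f x - g x) - h x)" by blast
  have "poly_fun n (e + 2 * Suc k) (\<lambda>x. g x + h x)"
    using poly_fun_mono[OF g(1), of "e + 2 * Suc k" n] h(1) by (intro poly_fun.add) auto
  with h(2) show ?case by (intro exI[of _ "\<lambda>x. g x + h x"]) (simp add: diff_diff_eq)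
qed

section \<open>Residue rings of finite dimension\<close>

lemma reduce_monom_fun:
  fixes I :: "((nat \<Rightarrow> 'a::field) \<Rightarrow> 'a) set"
  assumes I: "fun_ideal n I" and q: "\<And>i. i < n \<Longrightarrow> q i \<noteq> 0 \<and> (\<lambda>x. poly (q i) (x i)) \<in> I"
    and a: "a \<in> exponents n (Suc d)" and d: "(\<Sum>i<n. degree (q i)) \<le> d"
  shows "\<exists>g. poly_fun n d g \<and> (\<lambda>x. monom_fun n a x - g x) \<in> I"
proof (cases "a \<in> exponents n d")
  case True
  then show ?thesis using fun_idealD(1)[OF I] poly_fun_monom_fun[OF True, where 'a = 'a]
    by (intro exI[of _ "monom_fun n a"]) simp
next
  case False
  with a have sum_a: "(\<Sum>i<n. a i) = Suc d" by (auto simp: exponents_def)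
  \<comment> \<open>Pigeonhole: the exponents sum to more than the degrees of the
    \<open>q i\<close>, so some power of \<open>x i\<close> is divisible by the leading power of
    \<open>q i\<close> and can be rewritten by lower terms.\<close>
  then obtain i where i: "i < n" "degree (q i) < a i"
    using d sum_mono[of "{..<n}" a "\<lambda>i. degree (q i)"] by (metis Suc_n_not_le_n le_trans lessThan_iff not_less)
  define D where "D = degree (q i)"
  define c where "c = lead_coeff (q i)"
  have "c \<noteq> 0" using q[OF i(1)] by (simp add: c_def)
  define R where "R = (\<lambda>x :: nat \<Rightarrow> 'a. (\<Prod>j\<in>{..<n} - {i}. x j ^ a j) * x i ^ (a i - D))"
  define g where "g = (\<lambda>x. R x * (- (1 / c) * (\<Sum>l<D. coeff (q i) l * x i ^ l)))"
  have x: "poly_fun n 1 (\<lambda>x :: nat \<Rightarrow> 'a. x j)" if "j < n" for j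
    using poly_fun_var[of j n 0] that by simp
  have "poly_fun n ((\<Sum>j\<in>{..<n} - {i}. a j * 1) + (a i - D) * 1) R"
    unfolding R_def using i(1) by (intro poly_fun_mult poly_fun_prod poly_fun_power x) auto
  then have R: "poly_fun n ((\<Sum>j\<in>{..<n} - {i}. a j) + (a i - D)) R" by simp
  have "poly_fun n (D - 1) (\<lambda>x. - (1 / c) * (\<Sum>l<D. coeff (q i) l * x i ^ l))"
  proof (intro poly_fun_cmult poly_fun_sum)
    fix l assume "l \<in> {..<D}"
    then show "poly_fun n (D - 1) (\<lambda>x :: nat \<Rightarrow> 'a. x i ^ l)"
      using poly_fun_mono[OF poly_fun_power[OF x[OF i(1)], of l], of "D - 1" n] by auto
  qed
  from poly_fun_mult[OF R this]
  have "poly_fun n ((\<Sum>j\<in>{..<n} - {i}. a j) + (a i - D) + (D - 1)) g" unfolding g_def .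
  moreover have "(\<Sum>j\<in>{..<n} - {i}. a j) + (a i - D) + (D - 1) \<le> d" if "D > 0"
    using sum_a i that sum.remove[of "{..<n}" i a] by (simp add: D_def)
  \<comment> \<open>A nonzero constant \<open>q i\<close> is a separate case: the truncated
    \<open>D - 1\<close> saves no degree, but the sum of lower terms is empty and \<open>g\<close>
    is 0.\<close>
  moreover have "poly_fun n d g" if "D = 0"
    unfolding g_def by (simp add: that poly_fun.const)
  ultimately have "poly_fun n d g" by (cases "D = 0") (auto elim: poly_fun_mono)
  moreover have "monom_fun n a x - g x = (1 / c * R x) * poly (q i) (x i)" for x
  proof -
    have "poly (q i) (x i) = (\<Sum>l<D. coeff (q i) l * x i ^ l) + c * x i ^ D"
      unfolding poly_altdef D_def c_def by (simp add: lessThan_Suc_atMost[symmetric])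
    moreover have "monom_fun n a x = R x * x i ^ D"
      using i sum.remove[of "{..<n}" i a] prod.remove[of "{..<n}" i "\<lambda>j. x j ^ a j"]
      by (simp add: monom_fun_def R_def D_def power_add[symmetric] mult_ac)
    ultimately show ?thesis using \<open>c \<noteq> 0\<close> by (simp add: g_def field_simps)
  qed
  then have "(\<lambda>x. monom_fun n a x - g x) \<in> I"
    using fun_idealD(3)[OF I conjunct2[OF q[OF i(1)]] poly_fun_cmult[OF R, of "1 / c"]] by simp
  ultimately show ?thesis by blast
qed

lemma fun_ideal_sum:
  assumes "fun_ideal n I"
  shows "(\<And>i. i \<in> A \<Longrightarrow> f i \<in> I) \<Longrightarrow> (\<lambda>x. \<Sum>i\<in>A. f i x) \<in> I"
  by (induction A rule: infinite_finite_induct) (auto intro: fun_idealD[OF assms])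

lemma zero_dimensional_reduce:
  fixes I :: "((nat \<Rightarrow> 'a::field) \<Rightarrow> 'a) set"
  assumes I: "fun_ideal n I" and q: "\<And>i. i < n \<Longrightarrow> q i \<noteq> 0 \<and> (\<lambda>x. poly (q i) (x i)) \<in> I"
    and "poly_fun n d f"
  shows "\<exists>g. poly_fun n (\<Sum>i<n. degree (q i)) g \<and> (\<lambda>x. f x - g x) \<in> I"
  using assms(3)
proof (induction d arbitrary: f)
  case 0
  then show ?case
    using poly_fun_mono[of n 0 f _ n] fun_idealD(1)[OF I] by (intro exI[of _ f]) auto
next
  case (Suc d)
  show ?case
  proof (cases "(\<Sum>i<n. degree (q i)) \<le> d")
    case False
    then show ?thesis
      using poly_fun_mono[OF Suc.prems] fun_idealD(1)[OF I] by (intro exI[of _ f]) auto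
  next
    case True
    have "\<forall>a\<in>exponents n (Suc d). \<exists>g. poly_fun n d g \<and> (\<lambda>x. monom_fun n a x - g x) \<in> I"
      using reduce_monom_fun[OF I q _ True] by blast
    then obtain r where r: "\<And>a. a \<in> exponents n (Suc d) \<Longrightarrow> poly_fun n d (r a)"
      "\<And>a. a \<in> exponents n (Suc d) \<Longrightarrow> (\<lambda>x. monom_fun n a x - r a x) \<in> I" by metis
    obtain c where c: "\<And>x. f x = (\<Sum>a\<in>exponents n (Suc d). c a * monom_fun n a x)"
      using poly_fun_eq_sum_monom_fun[OF Suc.prems] by blast
    define g where "g = (\<lambda>x. \<Sum>a\<in>exponents n (Suc d). c a * r a x)"
    have "(\<lambda>x. f x - g x) = (\<lambda>x. \<Sum>a\<in>exponents n (Suc d). c a * (monom_fun n a x - r a x))"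
      by (simp add: c g_def right_diff_distrib sum_subtractf)
    also have "\<dots> \<in> I"
      using r(2) fun_idealD(3)[OF I _ poly_fun.const[of n 0]] by (intro fun_ideal_sum[OF I]) auto
    finally have 1: "(\<lambda>x. f x - g x) \<in> I" .
    have "poly_fun n d g"
      unfolding g_def by (intro poly_fun_sum poly_fun_cmult r(1))
    then obtain h where h: "poly_fun n (\<Sum>i<n. degree (q i)) h" "(\<lambda>x. g x - h x) \<in> I"
      using Suc.IH by blast
    from fun_idealD(2)[OF I 1 h(2)] have "(\<lambda>x. f x - h x) \<in> I" by simp
    with h(1) show ?thesis by blast
  qed
qed

section \<open>Counting zeros\<close>

lemma digits_less: "(\<And>i. i < n \<Longrightarrow> a i < b) \<Longrightarrow> (\<Sum>i<n. a i * b ^ i) < (b::nat) ^ n"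
proof (induction n)
  case (Suc n)
  then have "(\<Sum>i<n. a i * b ^ i) < b ^ n" "a n + 1 \<le> b" by (auto simp: Suc_le_eq)
  moreover from this(2) have "(a n + 1) * b ^ n \<le> b * b ^ n" by (rule mult_le_mono1)
  ultimately show ?case by simp
qed simp

lemma digits_unique:
  assumes "\<And>i. i < n \<Longrightarrow> a i < b" "\<And>i. i < n \<Longrightarrow> c i < (b::nat)"
    and "(\<Sum>i<n. a i * b ^ i) = (\<Sum>i<n. c i * b ^ i)" "i < n"
  shows "a i = c i"
  using assms
proof (induction n arbitrary: i)
  case (Suc n)
  have less: "(\<Sum>i<n. a i * b ^ i) < b ^ n" "(\<Sum>i<n. c i * b ^ i) < b ^ n"
    using Suc.prems by (auto intro: digits_less)
  have "(\<Sum>i<n. a i * b ^ i) = ((\<Sum>i<n. a i * b ^ i) + a n * b ^ n) mod b ^ n" using less by simp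
  also have "\<dots> = (\<Sum>i<n. c i * b ^ i)" using less Suc.prems(3) by simp
  finally have *: "(\<Sum>i<n. a i * b ^ i) = (\<Sum>i<n. c i * b ^ i)" .
  show ?case
  proof (cases "i = n")
    case True
    have "b > 0" using Suc.prems(1)[of n] by simp
    with * Suc.prems(3) True show ?thesis by simp
  next
    case False
    with Suc.IH[OF _ _ *] Suc.prems show ?thesis by simp
  qed
qed simp

text \<open>Weights nearly proportional to the total degree, but separating the exponent vectors.\<close>

definition weight :: "nat \<Rightarrow> nat \<Rightarrow> nat \<Rightarrow> nat" where
  "weight n e i = (e + 1) ^ n + (e + 1) ^ i"

definition exp_weight :: "nat \<Rightarrow> nat \<Rightarrow> (nat \<Rightarrow> nat) \<Rightarrow> nat" where
  "exp_weight n e a = (\<Sum>i<n. a i * weight n e i)"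

lemma exp_weight_eq:
  "exp_weight n e a = (\<Sum>i<n. a i) * (e + 1) ^ n + (\<Sum>i<n. a i * (e + 1) ^ i)"
  by (simp add: exp_weight_def weight_def distrib_left sum.distrib sum_distrib_right)

text \<open>Modulo \<open>(e + 1) ^ n\<close> the contribution of the total degree disappears. What
  remains is a number in base \<open>e + 1\<close> whose digits are the exponents.\<close>

lemma inj_on_exp_weight: "inj_on (exp_weight n e) (exponents n e)"
proof (rule inj_onI, rule ext)
  fix a b i assume *: "a \<in> exponents n e" "b \<in> exponents n e" "exp_weight n e a = exp_weight n e b"
  have less: "j < n \<Longrightarrow> a j < e + 1" "j < n \<Longrightarrow> b j < e + 1" for j
    using exponents_le[OF *(1)] exponents_le[OF *(2)] by (auto simp: less_Suc_eq_le)
  have "(\<Sum>i<n. a i * (e + 1) ^ i) = exp_weight n e a mod (e + 1) ^ n"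
    unfolding exp_weight_eq using digits_less[of n a "e + 1"] less(1) by simp
  also have "\<dots> = (\<Sum>i<n. b i * (e + 1) ^ i)"
    unfolding *(3) unfolding exp_weight_eq using digits_less[of n b "e + 1"] less(2) by simp
  finally show "a i = b i"
    using digits_unique[of n a "e + 1" b i] less *(1,2) by (cases "i < n") (auto simp: exponents_def)
qed

text \<open>The bound equals the order to which the power \<open>e + 1\<close> of the ideal vanishes
  along \<open>curve\<close>, so every monomial of degree at most \<open>e\<close> remains visible
  there.\<close>

lemma exp_weight_less:
  assumes "a \<in> exponents n e"
  shows "exp_weight n e a < (e + 1) ^ n * (e + 1)"
proof -
  have "exp_weight n e a < (\<Sum>i<n. a i) * (e + 1) ^ n + (e + 1) ^ n"
    unfolding exp_weight_eq using exponents_le[OF assms]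
    by (intro add_strict_left_mono digits_less) (auto simp: less_Suc_eq_le)
  also have "\<dots> = ((\<Sum>i<n. a i) + 1) * (e + 1) ^ n" by simp
  also have "\<dots> \<le> (e + 1) * (e + 1) ^ n"
    using assms by (intro mult_le_mono1) (auto simp: exponents_def)
  finally show ?thesis by (simp add: mult.commute)
qed

section \<open>Restriction to curves through a zero\<close>

lemma poly_ext_infinite:
  fixes p q :: "'a::idom poly"
  assumes "infinite (UNIV :: 'a set)" "\<And>t. poly p t = poly q t"
  shows "p = q"
proof (rule ccontr)
  assume "p \<noteq> q"
  then have "finite {t. poly (p - q) t = 0}" by (intro poly_roots_finite) simp
  with assms show False by simp
qed

text \<open>A curve through \<open>P\<close> at parameter 0 that turns the local monomial with
  exponents \<open>a\<close> into the power \<open>exp_weight n e a\<close> of the parameter.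
  Independence of several local monomials thus becomes a comparison of orders in one
  variable.\<close>

definition curve :: "nat \<Rightarrow> nat \<Rightarrow> (nat \<Rightarrow> 'a::comm_ring_1) \<Rightarrow> nat \<Rightarrow> 'a poly" where
  "curve n e P i = [:P i:] + [:0, 1:] ^ weight n e i"

text \<open>Every weight is at least \<open>(e + 1) ^ n\<close>, so below that order the curve is
  constant and so is every function on it.\<close>

lemma poly_fun_curve:
  fixes f :: "(nat \<Rightarrow> 'a::comm_ring_1) \<Rightarrow> 'a"
  assumes "poly_fun n d f"
  shows "\<exists>r. \<forall>t. poly ([:f P:] + [:0, 1:] ^ ((e + 1) ^ n) * r) t = f (\<lambda>i. poly (curve n e P i) t)"
  using assms
proof (induction rule: poly_fun.induct)
  case (const d c)
  show ?case by (intro exI[of _ 0]) simp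
next
  case (add d f g)
  then obtain r s where
    r: "\<And>t. poly ([:f P:] + [:0, 1:] ^ ((e + 1) ^ n) * r) t = f (\<lambda>i. poly (curve n e P i) t)" and
    s: "\<And>t. poly ([:g P:] + [:0, 1:] ^ ((e + 1) ^ n) * s) t = g (\<lambda>i. poly (curve n e P i) t)" by blast
  have "poly ([:f P + g P:] + [:0, 1:] ^ ((e + 1) ^ n) * (r + s)) t =
    f (\<lambda>i. poly (curve n e P i) t) + g (\<lambda>i. poly (curve n e P i) t)" for t
    unfolding r[symmetric] s[symmetric] by (simp add: distrib_left)
  then show ?case by blast
next
  case (var i d f)
  then obtain r where
    r: "\<And>t. f (\<lambda>i. poly (curve n e P i) t) = poly ([:f P:] + [:0, 1:] ^ ((e + 1) ^ n) * r) t" by metis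
  have "[:P i * f P:] + [:0, 1:] ^ ((e + 1) ^ n) *
      ([:P i:] * r + [:0, 1:] ^ ((e + 1) ^ i) * ([:f P:] + [:0, 1:] ^ ((e + 1) ^ n) * r)) =
    curve n e P i * ([:f P:] + [:0, 1:] ^ ((e + 1) ^ n) * r)"
  proof -
    have "[:P i * f P:] = [:P i:] * [:f P:]" by simp
    then show ?thesis unfolding curve_def weight_def power_add
      by (simp only: distrib_left distrib_right mult.assoc mult.left_commute add.assoc add.left_commute)
  qed
  then have "poly ([:P i * f P:] + [:0, 1:] ^ ((e + 1) ^ n) *
      ([:P i:] * r + [:0, 1:] ^ ((e + 1) ^ i) * ([:f P:] + [:0, 1:] ^ ((e + 1) ^ n) * r))) t =
    poly (curve n e P i) t * f (\<lambda>i. poly (curve n e P i) t)" for t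
    unfolding r by (simp only: poly_mult)
  then show ?case by blast
qed

text \<open>Each generator vanishes at \<open>P\<close> and hence to order
  \<open>(e + 1) ^ n\<close> along the curve; \<open>k\<close> factors multiply this order by
  \<open>k\<close>.\<close>

lemma ideal_pow_curve:
  fixes f :: "(nat \<Rightarrow> 'a::comm_ring_1) \<Rightarrow> 'a"
  assumes "ideal_pow n F k f"
    and F: "\<And>g. g \<in> F \<Longrightarrow> poly_fun n d g" "\<And>g. g \<in> F \<Longrightarrow> g P = 0"
  shows "\<exists>r. \<forall>t. poly ([:0, 1:] ^ ((e + 1) ^ n * k) * r) t = f (\<lambda>i. poly (curve n e P i) t)"
  using assms(1)
proof (induction rule: ideal_pow.induct)
  case (base d r)
  obtain q where "\<forall>t. poly q t = r (\<lambda>i. poly (curve n e P i) t)"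
    using poly_fun_univariate[OF base] by blast
  then show ?case by (intro exI[of _ q]) simp
next
  case (zero k)
  show ?case by (intro exI[of _ 0]) simp
next
  case (add k f g)
  then obtain r s where
    "\<forall>t. poly ([:0, 1:] ^ ((e + 1) ^ n * k) * r) t = f (\<lambda>i. poly (curve n e P i) t)"
    "\<forall>t. poly ([:0, 1:] ^ ((e + 1) ^ n * k) * s) t = g (\<lambda>i. poly (curve n e P i) t)" by blast
  then show ?case by (intro exI[of _ "r + s"]) (simp add: distrib_left)
next
  case (mult f k g)
  from mult obtain r where
    r: "\<forall>t. poly ([:0, 1:] ^ ((e + 1) ^ n * k) * r) t = g (\<lambda>i. poly (curve n e P i) t)" by blast
  obtain s where
    s: "\<forall>t. poly ([:f P:] + [:0, 1:] ^ ((e + 1) ^ n) * s) t = f (\<lambda>i. poly (curve n e P i) t)"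
    using poly_fun_curve[OF F(1)[OF mult(1)]] by blast
  have "[:0, 1:] ^ ((e + 1) ^ n * Suc k) * (s * r) =
    ([:f P:] + [:0, 1:] ^ ((e + 1) ^ n) * s) * ([:0, 1:] ^ ((e + 1) ^ n * k) * r)"
    by (simp add: F(2)[OF mult(1)] power_add mult_ac)
  then have "poly ([:0, 1:] ^ ((e + 1) ^ n * Suc k) * (s * r)) t =
    f (\<lambda>i. poly (curve n e P i) t) * g (\<lambda>i. poly (curve n e P i) t)" for t
    using r s by (metis poly_mult)
  then show ?case by blast
qed

text \<open>The function \<open>j\<close> selects coordinates that separate the points of \<open>W\<close>.\<close>

definition local_monom :: "nat \<Rightarrow> nat \<Rightarrow> ((nat \<Rightarrow> 'a) \<Rightarrow> (nat \<Rightarrow> 'a) \<Rightarrow> nat) \<Rightarrow> (nat \<Rightarrow> 'a) set \<Rightarrow>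
    (nat \<Rightarrow> 'a) \<Rightarrow> (nat \<Rightarrow> nat) \<Rightarrow> (nat \<Rightarrow> 'a) \<Rightarrow> 'a::comm_ring_1"
  where "local_monom n k j W Q a x =
    (\<Prod>i<n. (x i - Q i) ^ a i) * (\<Prod>P\<in>W - {Q}. (x (j Q P) - P (j Q P)) ^ k)"

lemma poly_fun_local_monom:
  assumes "\<And>P Q. P \<in> W \<Longrightarrow> Q \<in> W \<Longrightarrow> P \<noteq> Q \<Longrightarrow> j Q P < n" "Q \<in> W"
  shows "\<exists>d. poly_fun n d (local_monom n k j W Q a)"
proof -
  have lin: "poly_fun n 1 (\<lambda>x. x i - c)" if "i < n" for i and c :: 'a
    using poly_fun_diff[OF poly_fun_var[of i n 0] poly_fun.const[of n "Suc 0" c]] that by simp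
  have "poly_fun n ((\<Sum>i<n. a i * 1) + (\<Sum>P\<in>W - {Q}. k * 1)) (local_monom n k j W Q a)"
    unfolding local_monom_def[abs_def] using assms
    by (intro poly_fun_mult poly_fun_prod poly_fun_power lin) auto
  then show ?thesis by blast
qed

text \<open>On the curve through \<open>P\<close> both the relation and all terms belonging to other
  points vanish to order \<open>(e + 1) ^ n * (e + 1)\<close>. The terms at \<open>P\<close> have
  pairwise distinct smaller orders, so the one of least weight with nonzero coefficient cannot
  cancel.\<close>

lemma local_monom_independent:
  fixes W :: "(nat \<Rightarrow> 'a::field) set"
  assumes inf: "infinite (UNIV :: 'a set)" and fin: "finite W"
    and j: "\<And>P Q. P \<in> W \<Longrightarrow> Q \<in> W \<Longrightarrow> P \<noteq> Q \<Longrightarrow> j Q P < n \<and> P (j Q P) \<noteq> Q (j Q P)"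
    and F: "\<And>g. g \<in> F \<Longrightarrow> poly_fun n d g" "\<And>g P. g \<in> F \<Longrightarrow> P \<in> W \<Longrightarrow> g P = 0"
    and rel: "ideal_pow n F (e + 1)
      (\<lambda>x. \<Sum>(Q, a)\<in>W \<times> exponents n e. l (Q, a) * local_monom n (e + 1) j W Q a x)"
    and "P \<in> W" "a \<in> exponents n e"
  shows "l (P, a) = 0"
proof (rule ccontr)
  assume "l (P, a) \<noteq> 0"
  define A where "A = {a \<in> exponents n e. l (P, a) \<noteq> 0}"
  define wt where "wt = exp_weight n e"
  define T :: "'a poly" where "T = [:0, 1:]"
  define L where "L = (e + 1) ^ n"
  define \<gamma> where "\<gamma> = curve n e P"
  have \<gamma>: "\<gamma> i = [:P i:] + T ^ weight n e i" for i by (simp add: \<gamma>_def curve_def T_def)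
  have "finite A" "a \<in> A"
    using finite_exponents \<open>l (P, a) \<noteq> 0\<close> assms(8) by (auto simp: A_def)
  then obtain b where b: "b \<in> A" "\<And>c. c \<in> A \<Longrightarrow> wt b \<le> wt c"
    using arg_min_if_finite[of A wt] by (metis empty_iff linorder_not_less)
  have less: "wt b < wt c" if "c \<in> A - {b}" for c
  proof -
    have "wt b \<noteq> wt c"
      using inj_on_exp_weight[of n e] b(1) that unfolding wt_def A_def inj_on_def by blast
    with b(2)[of c] that show ?thesis by simp
  qed
  define U where "U = (\<lambda>Q a. (\<Prod>i<n. (\<gamma> i - [:Q i:]) ^ a i) *
    (\<Prod>R\<in>W - {Q}. (\<gamma> (j Q R) - [:R (j Q R):]) ^ (e + 1)))"
  define V where "V = (\<Prod>R\<in>W - {P}. (\<gamma> (j P R) - [:R (j P R):]) ^ (e + 1))"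
  have UP: "U P a = T ^ wt a * V" for a
  proof -
    have "(\<Prod>i<n. (\<gamma> i - [:P i:]) ^ a i) = (\<Prod>i<n. T ^ (weight n e i * a i))"
      by (simp add: \<gamma> power_mult)
    also have "\<dots> = T ^ wt a" by (simp add: power_sum wt_def exp_weight_def mult.commute)
    finally show ?thesis by (simp add: U_def V_def)
  qed
  have \<gamma>0: "poly (\<gamma> i) 0 = P i" for i
    by (simp add: \<gamma> T_def poly_power weight_def)
  have "P (j P R) - R (j P R) \<noteq> 0" if "R \<in> W - {P}" for R
    using j[of R P] that \<open>P \<in> W\<close> by auto
  then have V0: "poly V 0 \<noteq> 0"
    using fin by (simp add: V_def poly_prod \<gamma>0)
  have UQ: "T ^ (L * (e + 1)) dvd U Q a" if "Q \<in> W" "Q \<noteq> P" for Q a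
  proof -
    have "T ^ L dvd \<gamma> (j Q P) - [:P (j Q P):]"
      by (simp add: \<gamma> L_def weight_def le_imp_power_dvd)
    then have "(T ^ L) ^ (e + 1) dvd (\<gamma> (j Q P) - [:P (j Q P):]) ^ (e + 1)"
      by (rule dvd_power_same)
    also have "\<dots> dvd (\<Prod>R\<in>W - {Q}. (\<gamma> (j Q R) - [:R (j Q R):]) ^ (e + 1))"
      using that fin \<open>P \<in> W\<close> by (intro dvd_prodI) auto
    also have "\<dots> dvd U Q a" unfolding U_def by simp
    finally show ?thesis by (simp only: power_mult)
  qed
  obtain r where r: "\<And>t. poly (T ^ (L * (e + 1)) * r) t =
      (\<Sum>(Q, a)\<in>W \<times> exponents n e. l (Q, a) * local_monom n (e + 1) j W Q a (\<lambda>i. poly (\<gamma> i) t))"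
    using ideal_pow_curve[where n = n and F = F and d = d and P = P and e = e, OF rel] F \<open>P \<in> W\<close>
    unfolding T_def L_def \<gamma>_def by blast
  have "T ^ (L * (e + 1)) * r = (\<Sum>(Q, a)\<in>W \<times> exponents n e. [:l (Q, a):] * U Q a)"
    by (rule poly_ext_infinite[OF inf], unfold r)
      (simp add: poly_sum split_beta local_monom_def U_def poly_prod poly_power)
  also have "\<dots> = (\<Sum>Q\<in>W. \<Sum>a\<in>exponents n e. [:l (Q, a):] * U Q a)"
    by (simp add: sum.cartesian_product)
  also have "\<dots> = (\<Sum>a\<in>exponents n e. [:l (P, a):] * U P a) +
      (\<Sum>Q\<in>W - {P}. \<Sum>a\<in>exponents n e. [:l (Q, a):] * U Q a)"
    using fin \<open>P \<in> W\<close> by (rule sum.remove)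
  finally have "(\<Sum>a\<in>exponents n e. [:l (P, a):] * U P a) = T ^ (L * (e + 1)) * r -
      (\<Sum>Q\<in>W - {P}. \<Sum>a\<in>exponents n e. [:l (Q, a):] * U Q a)" by (simp add: algebra_simps)
  also have "T ^ (L * (e + 1)) dvd \<dots>"
    by (intro dvd_diff dvd_sum dvd_mult dvd_triv_left UQ) auto
  finally have dvd1: "T ^ (L * (e + 1)) dvd (\<Sum>a\<in>exponents n e. [:l (P, a):] * U P a)" .
  have "(\<Sum>a\<in>exponents n e. [:l (P, a):] * U P a) = (\<Sum>a\<in>A. [:l (P, a):] * U P a)"
    using finite_exponents by (intro sum.mono_neutral_right) (auto simp: A_def)
  also have "\<dots> = [:l (P, b):] * U P b + (\<Sum>a\<in>A - {b}. [:l (P, a):] * U P a)"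
    using \<open>finite A\<close> b(1) by (rule sum.remove)
  also have "\<dots> = T ^ wt b * ([:l (P, b):] * V) +
      (\<Sum>a\<in>A - {b}. T ^ wt b * (T * (T ^ (wt a - wt b - 1) * ([:l (P, a):] * V))))"
  proof -
    have "T ^ wt a = T ^ wt b * (T * T ^ (wt a - wt b - 1))" if "a \<in> A - {b}" for a
      using less[OF that] by (simp add: power_Suc[symmetric] power_add[symmetric] del: power_Suc)
    then show ?thesis unfolding UP by (intro arg_cong2[where f = "(+)"] sum.cong) (auto simp: mult_ac)
  qed
  also have "\<dots> = T ^ wt b * ([:l (P, b):] * V + T * (\<Sum>a\<in>A - {b}. T ^ (wt a - wt b - 1) * ([:l (P, a):] * V)))"
    by (simp add: sum_distrib_left distrib_left)
  finally have "T ^ (L * (e + 1)) dvd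
    T ^ wt b * ([:l (P, b):] * V + T * (\<Sum>a\<in>A - {b}. T ^ (wt a - wt b - 1) * ([:l (P, a):] * V)))"
    using dvd1 by simp
  \<comment> \<open>Strictness leaves one factor \<open>T\<close> after \<open>T ^ wt b\<close> is
    cancelled. The surviving constant term is \<open>l (P, b)\<close> times the nonzero value of
    \<open>V\<close> at 0.\<close>
  moreover have "wt b < L * (e + 1)"
    using exp_weight_less[of b n e] b(1) by (simp add: wt_def L_def A_def)
  then have "T ^ wt b * T dvd T ^ (L * (e + 1))"
    by (simp add: power_Suc2[symmetric] le_imp_power_dvd del: power_Suc power_Suc2)
  ultimately have "T ^ wt b * T dvd
    T ^ wt b * ([:l (P, b):] * V + T * (\<Sum>a\<in>A - {b}. T ^ (wt a - wt b - 1) * ([:l (P, a):] * V)))"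
    by (rule dvd_trans[rotated])
  then have "T dvd [:l (P, b):] * V + T * (\<Sum>a\<in>A - {b}. T ^ (wt a - wt b - 1) * ([:l (P, a):] * V))"
    by (subst (asm) dvd_times_left_cancel_iff) (auto simp: T_def)
  then have "T dvd [:l (P, b):] * V" by (simp add: dvd_add_left_iff)
  then obtain k where "[:l (P, b):] * V = T * k" by (elim dvdE)
  then have "poly ([:l (P, b):] * V) 0 = poly (T * k) 0" by simp
  also have "\<dots> = 0" by (simp add: T_def)
  finally have "poly ([:l (P, b):] * V) 0 = 0" .
  with V0 b(1) show False by (simp add: A_def)
qed

text \<open>If \<open>I\<close> is generated by quadrics and the residue ring is finite-dimensional, then functions of
  degree \<open>e + 2 k\<close> span the residue ring of \<open>I ^ (k + 1)\<close>. This residue ring maps onto the jets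
  of order \<open>k\<close> at the common zeros, and comparing dimensions for \<open>k = e\<close> bounds their number.\<close>

lemma card_zeros_le:
  fixes W :: "(nat \<Rightarrow> 'a::field) set"
  assumes inf: "infinite (UNIV :: 'a set)" and fin: "finite W"
    and W: "\<And>P i. P \<in> W \<Longrightarrow> i \<ge> n \<Longrightarrow> P i = 0"
    and F: "\<And>g. g \<in> F \<Longrightarrow> poly_fun n 2 g" "\<And>g P. g \<in> F \<Longrightarrow> P \<in> W \<Longrightarrow> g P = 0"
    and q: "\<And>i. i < n \<Longrightarrow> \<exists>q. q \<noteq> 0 \<and> ideal_pow n F 1 (\<lambda>x. poly q (x i))"
  shows "card W \<le> 3 ^ n"
proof -
  from q obtain q where q: "\<And>i. i < n \<Longrightarrow> q i \<noteq> 0 \<and> (\<lambda>x. poly (q i) (x i)) \<in> {f. ideal_pow n F 1 f}"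
    unfolding mem_Collect_eq by metis
  define e where "e = (\<Sum>i<n. degree (q i))"
  have red: "\<exists>g. poly_fun n e g \<and> ideal_pow n F 1 (\<lambda>x. f x - g x)" if "poly_fun n d f" for d f
    using zero_dimensional_reduce[OF fun_ideal_pow q that] unfolding e_def by simp
  \<comment> \<open>Since points of \<open>W\<close> are 0 beyond \<open>n\<close>, distinct ones
    differ in a coordinate below \<open>n\<close>.\<close>
  have "\<forall>Q P. \<exists>i. P \<in> W \<and> Q \<in> W \<and> P \<noteq> Q \<longrightarrow> i < n \<and> P i \<noteq> Q i"
    using W by (metis ext linorder_not_less)
  then obtain j where j: "\<And>P Q. P \<in> W \<Longrightarrow> Q \<in> W \<Longrightarrow> P \<noteq> Q \<Longrightarrow> j Q P < n \<and> P (j Q P) \<noteq> Q (j Q P)"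
    by metis
  define A where "A = W \<times> exponents n e"
  define u where "u = (\<lambda>(Q, a). local_monom n (e + 1) j W Q a)"
  have "\<exists>g. poly_fun n (3 * e) g \<and> ideal_pow n F (e + 1) (\<lambda>x. u z x - g x)" if z: "z \<in> A" for z
  proof -
    obtain d where "poly_fun n d (u z)"
      using poly_fun_local_monom[of W j n "fst z" "e + 1" "snd z"] j z by (auto simp: A_def u_def split_beta)
    \<comment> \<open>With \<open>k = e\<close> the degree \<open>e + 2 * k\<close> is
      \<open>3 * e\<close>.\<close>
    from ideal_pow_reduce[OF this F(1) red, where k = e] show ?thesis by simp
  qed
  then obtain g where g: "\<And>z. z \<in> A \<Longrightarrow> poly_fun n (3 * e) (g z)"
    "\<And>z. z \<in> A \<Longrightarrow> ideal_pow n F (e + 1) (\<lambda>x. u z x - g z x)" by metis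
  from g(1) have "\<forall>z\<in>A. \<exists>c. \<forall>x. g z x = (\<Sum>a\<in>exponents n (3 * e). c a * monom_fun n a x)"
    using poly_fun_eq_sum_monom_fun by blast
  then obtain M where M: "\<And>z x. z \<in> A \<Longrightarrow> g z x = (\<Sum>a\<in>exponents n (3 * e). M z a * monom_fun n a x)"
    by metis
  have "card A \<le> card (exponents n (3 * e))"
  proof (rule ccontr)
    assume "\<not> card A \<le> card (exponents n (3 * e))"
    moreover have "finite A" using fin finite_exponents by (simp add: A_def)
    ultimately obtain l where l: "\<exists>z\<in>A. l z \<noteq> 0"
      "\<And>b. b \<in> exponents n (3 * e) \<Longrightarrow> (\<Sum>z\<in>A. l z * M z b) = 0"
      using linear_relation_exists[of "exponents n (3 * e)" A M] finite_exponents by auto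
    have "(\<Sum>z\<in>A. l z * g z x) = 0" for x
    proof -
      have "(\<Sum>z\<in>A. l z * g z x) = (\<Sum>z\<in>A. \<Sum>b\<in>exponents n (3 * e). l z * M z b * monom_fun n b x)"
        by (intro sum.cong) (auto simp: M sum_distrib_left mult.assoc)
      also have "\<dots> = (\<Sum>b\<in>exponents n (3 * e). (\<Sum>z\<in>A. l z * M z b) * monom_fun n b x)"
        by (subst sum.swap) (simp add: sum_distrib_right)
      finally show ?thesis by (simp add: l(2))
    qed
    then have "(\<lambda>x. \<Sum>z\<in>A. l z * u z x) = (\<lambda>x. \<Sum>z\<in>A. l z * (u z x - g z x))"
      by (simp add: right_diff_distrib sum_subtractf)
    moreover have "ideal_pow n F (e + 1) (\<lambda>x. \<Sum>z\<in>A. l z * (u z x - g z x))"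
      by (intro ideal_pow_sum ideal_pow_times[OF _ poly_fun.const[of n 0]] g(2))
    ultimately have "ideal_pow n F (e + 1)
      (\<lambda>x. \<Sum>(Q, a)\<in>W \<times> exponents n e. l (Q, a) * local_monom n (e + 1) j W Q a x)"
      by (simp add: A_def u_def split_beta)
    then have "l (P, a) = 0" if "P \<in> W" "a \<in> exponents n e" for P a
      using local_monom_independent[where l = l and j = j and W = W and F = F and n = n and e = e and d = 2]
        inf fin j F that by blast
    with l(1) show False by (auto simp: A_def)
  qed
  also have "\<dots> \<le> 3 ^ n * card (exponents n e)" by (rule card_exponents_triple)
  finally have "card W * card (exponents n e) \<le> 3 ^ n * card (exponents n e)"
    by (simp add: A_def card_cartesian_product)
  moreover have "(\<lambda>_. 0) \<in> exponents n e" by (simp add: exponents_def)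
  then have "card (exponents n e) > 0" using finite_exponents by (auto simp: card_gt_0_iff)
  ultimately show ?thesis by simp
qed

section \<open>Zeros over finite fields\<close>

lemma card_simple_roots:
  fixes f :: "'a::alg_closed_field poly"
  assumes "f \<noteq> 0" "\<And>x. poly f x = 0 \<Longrightarrow> poly (pderiv f) x \<noteq> 0"
  shows "card {x. poly f x = 0} = degree f"
  using assms
proof (induction "degree f" arbitrary: f)
  case 0
  then obtain c where "f = [:c:]" "c \<noteq> 0" by (metis degree_eq_zeroE pCons_0_0)
  then show ?case by simp
next
  case (Suc d)
  then obtain x where x: "poly f x = 0" using alg_closed_imp_poly_has_root[of f] by auto
  then obtain g where g: "f = [:-x, 1:] * g" by (auto simp: poly_eq_0_iff_dvd elim: dvdE)
  have "g \<noteq> 0" using Suc.prems(1) g by auto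
  have deriv: "poly (pderiv f) y = poly g y + (y - x) * poly (pderiv g) y" for y
    unfolding g pderiv_mult by (simp add: pderiv_pCons algebra_simps)
  have "degree f = Suc (degree g)" using \<open>g \<noteq> 0\<close> unfolding g by (subst degree_mult_eq) auto
  have "poly g x \<noteq> 0" using Suc.prems(2)[OF x] deriv[of x] by simp
  moreover have "poly (pderiv g) y \<noteq> 0" if "poly g y = 0" for y
    using Suc.prems(2)[of y] deriv[of y] that by (auto simp: g)
  then have "card {y. poly g y = 0} = degree g"
    using Suc.hyps(1)[of g] Suc.hyps(2) \<open>g \<noteq> 0\<close> \<open>degree f = Suc (degree g)\<close> by simp
  moreover have "{y. poly f y = 0} = insert x {y. poly g y = 0}" by (auto simp: g)
  ultimately show ?case
    using \<open>degree f = Suc (degree g)\<close> poly_roots_finite[OF \<open>g \<noteq> 0\<close>] by simp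
qed

text \<open>In characteristic \<open>p\<close> the polynomial \<open>X ^ Q - X\<close>, with
  \<open>Q\<close> a positive power of \<open>p\<close>, has derivative \<open>-1\<close>, hence
  only simple roots.\<close>

lemma card_frobenius_fixed:
  assumes "prime CHAR('a::alg_closed_field)" "k > 0"
  shows "card {c :: 'a. c ^ (CHAR('a) ^ k) = c} = CHAR('a) ^ k"
proof -
  define Q where "Q = CHAR('a) ^ k"
  have "Q > 1" unfolding Q_def using prime_gt_1_nat[OF assms(1)] assms(2) by (rule one_less_power)
  define f :: "'a poly" where "f = monom 1 Q - [:0, 1:]"
  have "degree f = Q"
    unfolding f_def diff_conv_add_uminus using \<open>Q > 1\<close>
    by (subst degree_add_eq_left) (auto simp: degree_monom_eq)
  have "of_nat Q = (0 :: 'a)" using assms(2) by (simp add: Q_def)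
  then have "pderiv f = - 1"
    by (simp add: f_def pderiv_diff pderiv_monom pderiv_pCons one_pCons)
  then have "card {c. poly f c = 0} = degree f"
    using \<open>degree f = Q\<close> \<open>Q > 1\<close> by (intro card_simple_roots) auto
  then show ?thesis using \<open>degree f = Q\<close> by (simp add: f_def poly_monom Q_def)
qed

lemma frobenius_diff:
  fixes x y :: "'a::comm_ring_1"
  assumes "prime CHAR('a)"
  shows "(x - y) ^ (CHAR('a) ^ k) = x ^ (CHAR('a) ^ k) - y ^ (CHAR('a) ^ k)"
  using freshmans_dream'[OF assms refl, of "x - y" y k] by (simp add: algebra_simps)

lemma frobenius_inj:
  fixes x y :: "'a::field"
  assumes "prime CHAR('a)" "x ^ (CHAR('a) ^ k) = y ^ (CHAR('a) ^ k)"
  shows "x = y"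
  using frobenius_diff[OF assms(1), of x y k] assms(2) by simp

text \<open>The transposition \<open>s\<close> of the coordinates 0 and \<open>i\<close> is its own
  inverse and preserves degrees, so the result for \<open>x 0\<close> carries over.\<close>

lemma elimination_coordinate:
  fixes I :: "((nat \<Rightarrow> 'a::alg_closed_field) \<Rightarrow> 'a) set"
  assumes I: "fun_ideal (Suc m) I" and "i \<le> m"
  shows "(\<exists>q. q \<noteq> 0 \<and> (\<lambda>x. poly q (x i)) \<in> I) \<or>
    (\<exists>E. finite E \<and> card E \<le> elim_bound m d \<and>
      (\<forall>c. c \<notin> E \<longrightarrow> (\<exists>x. x i = c \<and> (\<forall>f\<in>I. poly_fun (Suc m) d f \<longrightarrow> f x = 0))))"
proof -
  define s where "s = (\<lambda>(x :: nat \<Rightarrow> 'a) k. x (if k = 0 then i else if k = i then 0 else k))"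
  have ss: "s (s x) = x" for x by (auto simp: s_def)
  have s: "poly_fun (Suc m) e (\<lambda>x. h (s x))" if "poly_fun (Suc m) e h" for e h
    unfolding s_def using that
  proof (rule poly_fun_subst)
    fix k assume "k < Suc m"
    then show "poly_fun (Suc m) 1 (\<lambda>x :: nat \<Rightarrow> 'a. x (if k = 0 then i else if k = i then 0 else k))"
      using poly_fun_var[of "if k = 0 then i else if k = i then 0 else k" "Suc m" 0, where 'a = 'a] assms(2)
      by auto
  qed
  define J where "J = {g. (\<lambda>x. g (s x)) \<in> I}"
  have J: "fun_ideal (Suc m) J"
    unfolding fun_ideal_def J_def mem_Collect_eq
  proof (intro conjI ballI allI impI)
    fix f h :: "(nat \<Rightarrow> 'a) \<Rightarrow> 'a" and e
    assume "f \<in> {g. (\<lambda>x. g (s x)) \<in> I}" "poly_fun (Suc m) e h"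
    then show "(\<lambda>x. h (s x) * f (s x)) \<in> I" using fun_idealD(3)[OF I _ s[of e h]] by auto
  qed (use fun_idealD(1,2)[OF I] in auto)
  from elimination[OF J, of d] show ?thesis
  proof (elim disjE exE conjE)
    fix q :: "'a poly" assume "q \<noteq> 0" "(\<lambda>x. poly q (x 0)) \<in> J"
    then show ?thesis by (auto simp: J_def s_def)
  next
    fix E :: "'a set"
    assume E: "finite E" "card E \<le> elim_bound m d"
      "\<forall>c. c \<notin> E \<longrightarrow> (\<exists>x. x 0 = c \<and> (\<forall>f\<in>J. poly_fun (Suc m) d f \<longrightarrow> f x = 0))"
    have "\<exists>x. x i = c \<and> (\<forall>f\<in>I. poly_fun (Suc m) d f \<longrightarrow> f x = 0)" if "c \<notin> E" for c
    proof -
      from E(3) that obtain y where y: "y 0 = c" "\<And>f. f \<in> J \<Longrightarrow> poly_fun (Suc m) d f \<Longrightarrow> f y = 0" by blast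
      have "f (s y) = 0" if "f \<in> I" "poly_fun (Suc m) d f" for f
        using y(2)[of "\<lambda>x. f (s x)"] that s[OF that(2)] by (simp add: J_def ss)
      moreover have "s y i = c" using y(1) by (simp add: s_def)
      ultimately show ?thesis by blast
    qed
    with E(1,2) show ?thesis by blast
  qed
qed

lemma frobenius_iterate:
  fixes f :: "(nat \<Rightarrow> 'a::comm_ring_1) \<Rightarrow> 'a"
  assumes "\<And>x. f (\<lambda>i. x i ^ p) = f x ^ p"
  shows "f (\<lambda>i. x i ^ (p ^ k)) = f x ^ (p ^ k)"
proof (induction k)
  case (Suc k)
  have "f (\<lambda>i. x i ^ (p ^ Suc k)) = f (\<lambda>i. (x i ^ (p ^ k)) ^ p)"
    by (simp add: power_mult[symmetric] mult.commute)
  also have "\<dots> = (f x ^ (p ^ k)) ^ p" unfolding assms Suc.IH ..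
  finally show ?case by (simp add: power_mult[symmetric] mult.commute)
qed simp

text \<open>Among the common zeros choose one with as many coordinates as possible in the field with
  \<open>p ^ 2 ^ n\<close> elements, and fix these coordinates. By elimination no other coordinate can then take
  cofinitely many values, so the zeros with the fixed coordinates are finite in number, and the
  Frobenius map acts on them with short orbits.\<close>

lemma zero_of_small_degree:
  fixes F :: "((nat \<Rightarrow> 'a::alg_closed_field) \<Rightarrow> 'a) set"
  assumes p: "prime CHAR('a)" and "n > 0"
    and F: "\<And>f. f \<in> F \<Longrightarrow> poly_fun n 2 f"
      "\<And>f x. f \<in> F \<Longrightarrow> f (\<lambda>i. x i ^ CHAR('a)) = f x ^ CHAR('a)"
    and zero: "\<exists>x. \<forall>f\<in>F. f x = 0"
  shows "\<exists>k x. 0 < k \<and> k \<le> 6 ^ n \<and> (\<forall>f\<in>F. f x = 0) \<and> (\<forall>i<n. x i ^ (CHAR('a) ^ k) = x i)"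
proof -
  define Q where "Q = CHAR('a) ^ 2 ^ n"
  define FQ where "FQ = {c :: 'a. c ^ Q = c}"
  have "Q > 0" using prime_gt_0_nat[OF p] by (simp add: Q_def)
  have card_FQ: "card FQ = Q" unfolding FQ_def Q_def by (rule card_frobenius_fixed[OF p]) simp
  define T where "T = (\<lambda>x. {i. i < n \<and> x i \<in> FQ})"
  have "card (T x) \<le> n" for x
    using card_mono[of "{..<n}" "T x"] by (auto simp: T_def)
  then have bound: "\<forall>y. (\<forall>f\<in>F. f y = 0) \<longrightarrow> card (T y) < Suc n" by (simp add: less_Suc_eq_le)
  obtain z where z: "\<forall>f\<in>F. f z = 0" "\<And>y. \<forall>f\<in>F. f y = 0 \<Longrightarrow> card (T y) \<le> card (T z)"
    using zero Lattices_Big.ex_has_greatest_nat[OF _ bound] by blast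
  \<comment> \<open>The equations fixing coordinates are linear, so the enlarged system still has
    degree at most 2 and the bound for quadrics applies.\<close>
  define F' where "F' = F \<union> (\<lambda>i x. x i - z i) ` T z"
  have F': "poly_fun n 2 f" if f: "f \<in> F'" for f
  proof (cases "f \<in> F")
    case False
    then obtain i where "i < n" "f = (\<lambda>x. x i - z i)" using f by (auto simp: F'_def T_def)
    then show ?thesis
      using poly_fun_diff[OF poly_fun_var[of i n 1] poly_fun.const[of n "Suc 1" "z i"]]
      by (simp add: numeral_2_eq_2)
  qed (rule F(1))
  have coord: "\<exists>q. q \<noteq> 0 \<and> ideal_pow n F' 1 (\<lambda>x. poly q (x i))" if "i < n" for i
  proof (cases "i \<in> T z")
    case True
    then have "(\<lambda>x. x i - z i) \<in> F'" by (auto simp: F'_def)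
    then have "ideal_pow n F' 1 (\<lambda>x. poly [:- z i, 1:] (x i))"
      by (intro ideal_pow_1) (simp add: algebra_simps)
    then show ?thesis by (intro exI[of _ "[:- z i, 1:]"]) simp
  next
    case False
    obtain m where m: "n = Suc m" using \<open>n > 0\<close> gr0_implies_Suc by blast
    have "fun_ideal (Suc m) {f. ideal_pow n F' 1 f}" unfolding m by (rule fun_ideal_pow)
    from elimination_coordinate[OF this, of i 2] that
    consider q where "q \<noteq> 0" "ideal_pow n F' 1 (\<lambda>x. poly q (x i))"
      | E where "finite E" "card E \<le> elim_bound m 2"
        "\<And>c. c \<notin> E \<Longrightarrow> \<exists>x. x i = c \<and> (\<forall>f. ideal_pow n F' 1 f \<longrightarrow> poly_fun n 2 f \<longrightarrow> f x = 0)"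
      unfolding m by auto
    then show ?thesis
    proof cases
      case (2 E)
      have "elim_bound m 2 + 2 \<le> (2 * 2) ^ 2 ^ m" by (rule elim_bound_le) simp
      also have "\<dots> = (2 ^ 2) ^ 2 ^ m" by simp
      also have "\<dots> = 2 ^ 2 ^ n" unfolding m by (simp only: power_mult[symmetric] power_Suc)
      also have "\<dots> \<le> Q" unfolding Q_def using prime_ge_2_nat[OF p] by (rule power_mono) simp
      \<comment> \<open>Some element of \<open>FQ\<close> is not exceptional. It yields a zero with
        one more coordinate in \<open>FQ\<close>, against the choice of \<open>z\<close>.\<close>
      finally have "card E < card FQ" using 2(2) by (simp add: card_FQ)
      then have "\<not> FQ \<subseteq> E" using card_mono[OF 2(1), of FQ] by auto
      then obtain c where c: "c \<in> FQ" "c \<notin> E" by blast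
      from 2(3)[OF c(2)] obtain x where x: "x i = c" "\<And>f. f \<in> F' \<Longrightarrow> f x = 0"
        using ideal_pow_1 F' by blast
      have "insert i (T z) \<subseteq> T x"
      proof
        fix k assume "k \<in> insert i (T z)"
        then show "k \<in> T x"
        proof
          assume "k = i"
          then show ?thesis using x(1) c(1) that by (simp add: T_def)
        next
          assume "k \<in> T z"
          moreover from this have "x k - z k = 0" using x(2)[of "\<lambda>x. x k - z k"] by (auto simp: F'_def)
          ultimately show ?thesis by (simp add: T_def)
        qed
      qed
      then have "card (insert i (T z)) \<le> card (T x)" by (rule card_mono[rotated]) (simp add: T_def)
      moreover have "card (insert i (T z)) = Suc (card (T z))"
        using False by (intro card_insert_disjoint) (auto simp: T_def)
      moreover have "card (T x) \<le> card (T z)" using x(2) by (intro z(2)) (auto simp: F'_def)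
      ultimately show ?thesis by simp
    qed blast
  qed
  define W where "W = {x. (\<forall>i\<ge>n. x i = 0) \<and> (\<forall>f\<in>F'. f x = 0)}"
  \<comment> \<open>The counting lemma bounds every finite subset of \<open>W\<close> by the same
    number, which gives finiteness as well.\<close>
  have W: "finite W \<and> card W \<le> 3 ^ n"
  proof (rule finite_if_finite_subsets_card_bdd)
    fix G assume "G \<subseteq> W" "finite G"
    then show "card G \<le> 3 ^ n"
      using coord by (intro card_zeros_le[OF infinite_UNIV_alg_closed, of G n F'] F') (auto simp: W_def)
  qed
  define y where "y = (\<lambda>i. if i < n then z i else 0)"
  have zF': "f z = 0" if "f \<in> F'" for f using that z(1) by (auto simp: F'_def)
  have "f y = 0" if "f \<in> F'" for f
    using poly_fun_cong[OF F'[OF that], of y z] zF'[OF that] by (simp add: y_def)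
  then have "y \<in> W" by (simp add: W_def y_def)
  define \<Phi> where "\<Phi> = (\<lambda>j i. y i ^ (Q ^ j))"
  have Qj: "Q ^ j = CHAR('a) ^ (2 ^ n * j)" for j by (simp add: Q_def power_mult)
  \<comment> \<open>The original equations commute with the Frobenius map, and the added ones
    survive because the fixed values lie in \<open>FQ\<close>.\<close>
  have "\<Phi> j \<in> W" for j
  proof -
    have "f (\<Phi> j) = 0" if f: "f \<in> F'" for f
    proof (cases "f \<in> F")
      case True
      then have "f (\<Phi> j) = f y ^ (CHAR('a) ^ (2 ^ n * j))"
        unfolding \<Phi>_def Qj using F(2) by (intro frobenius_iterate) auto
      also have "f y = 0" using \<open>y \<in> W\<close> that by (simp add: W_def)
      finally show ?thesis using prime_gt_0_nat[OF p] by simp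
    next
      case False
      then obtain i where i: "i \<in> T z" "f = (\<lambda>x. x i - z i)" using f by (auto simp: F'_def)
      have "z i ^ (Q ^ j) = z i"
        using i(1) by (induction j) (auto simp: T_def FQ_def power_mult)
      then show ?thesis using i by (simp add: \<Phi>_def y_def T_def)
    qed
    then show ?thesis using \<open>Q > 0\<close> by (simp add: W_def \<Phi>_def y_def)
  qed
  \<comment> \<open>One more iterate than \<open>W\<close> has points: two of them coincide, and
    injectivity of the Frobenius map makes \<open>y\<close> itself periodic with period at most
    \<open>card W\<close>.\<close>
  then have "\<Phi> ` {..card W} \<subseteq> W" by blast
  then have "card (\<Phi> ` {..card W}) \<le> card W" using W by (intro card_mono) auto
  then have "\<not> inj_on \<Phi> {..card W}" using card_image[of \<Phi> "{..card W}"] by auto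
  then obtain a b where ab: "a < b" "b \<le> card W" "\<Phi> a = \<Phi> b"
    unfolding inj_on_def by (metis atMost_iff linorder_neqE_nat)
  have fixed: "y i ^ (CHAR('a) ^ (2 ^ n * (b - a))) = y i" for i
  proof -
    have "y i ^ (Q ^ a) = y i ^ (Q ^ b)" using ab(3) by (simp add: \<Phi>_def fun_eq_iff)
    also have "Q ^ b = Q ^ (b - a) * Q ^ a" using ab(1) by (simp add: power_add[symmetric])
    finally have "(y i ^ (Q ^ (b - a))) ^ (Q ^ a) = y i ^ (Q ^ a)" by (simp add: power_mult)
    then show ?thesis using frobenius_inj[OF p] unfolding Qj by blast
  qed
  have "2 ^ n * (b - a) \<le> 2 ^ n * 3 ^ n" using ab W by (intro mult_le_mono2) linarith
  also have "\<dots> = (6 :: nat) ^ n" by (simp add: power_mult_distrib[symmetric])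
  finally have "2 ^ n * (b - a) \<le> 6 ^ n" .
  moreover have "0 < 2 ^ n * (b - a)" using ab(1) by simp
  moreover have "\<forall>f\<in>F. f y = 0" using \<open>y \<in> W\<close> by (simp add: W_def F'_def)
  ultimately show ?thesis using fixed by blast
qed

section \<open>Sums-of-squares formulas\<close>

lemma lookup_sos_const_times: "Poly_Mapping.lookup (sos_const c * q) \<mu> = c * Poly_Mapping.lookup q \<mu>"
proof -
  have "Poly_Mapping.lookup (sos_const c * q) \<mu> = Poly_Mapping.lookup (Poly_Mapping.map ((*) c) q) \<mu>"
    by (simp add: sos_const_def mult_map_scale_conv_mult)
  then show ?thesis by (simp add: map.rep_eq when_def)
qed

definition sos_xy :: "nat \<times> nat \<Rightarrow> 'a::field sos_poly" where
  "sos_xy u = sos_x (fst u) * sos_y (snd u)"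

definition sos_product_coeff :: "(sos_var \<Rightarrow>\<^sub>0 nat) \<Rightarrow> nat \<times> nat \<Rightarrow> nat \<times> nat \<Rightarrow> 'a::field" where
  "sos_product_coeff \<mu> u v = Poly_Mapping.lookup (sos_xy u * sos_xy v) \<mu>"

text \<open>The values 0 and 1 are fixed by the Frobenius map; this is how the definition of the
  system over the prime field enters.\<close>

lemma sos_product_coeff_cases: "(sos_product_coeff \<mu> u v :: 'a::field) \<in> {0, 1}"
  by (simp add: sos_product_coeff_def sos_xy_def sos_x_def sos_y_def mult_single lookup_single when_def)

text \<open>Used in both directions: a given formula provides a zero of the quadratic system, and
  the zero found in a finite field is turned back into a formula.\<close>

lemma sos_coefficients:
  fixes \<alpha> :: "nat \<Rightarrow> nat \<Rightarrow> nat \<Rightarrow> 'a::field"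
  shows "(\<Sum>j=1..r. sos_x j ^ 2) * (\<Sum>k=1..s. sos_y k ^ 2) =
      (\<Sum>i=1..n. (\<Sum>j=1..r. \<Sum>k=1..s. sos_const (\<alpha> i j k) * sos_x j * sos_y k) ^ 2) \<longleftrightarrow>
    (\<forall>\<mu>. (\<Sum>i=1..n. \<Sum>u\<in>{1..r}\<times>{1..s}. \<Sum>v\<in>{1..r}\<times>{1..s}.
        \<alpha> i (fst u) (snd u) * \<alpha> i (fst v) (snd v) * sos_product_coeff \<mu> u v) -
      (\<Sum>u\<in>{1..r}\<times>{1..s}. sos_product_coeff \<mu> u u) = 0)"
proof -
  define J where "J = {1..r} \<times> {1..s}"
  define a where "a = (\<lambda>i u. \<alpha> i (fst u) (snd u))"
  have const: "sos_const c * sos_const d = sos_const (c * d)" for c d :: 'a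
    by (simp add: sos_const_def mult_single)
  have "(\<Sum>j=1..r. sos_x j ^ 2) * (\<Sum>k=1..s. sos_y k ^ 2) =
      (\<Sum>u\<in>J. sos_xy u * sos_xy u :: 'a sos_poly)"
    unfolding J_def sum_product sum.cartesian_product
    by (intro sum.cong) (auto simp: sos_xy_def power2_eq_square mult_ac)
  then have lhs: "Poly_Mapping.lookup ((\<Sum>j=1..r. sos_x j ^ 2) * (\<Sum>k=1..s. sos_y k ^ 2) :: 'a sos_poly) \<mu> =
      (\<Sum>u\<in>J. sos_product_coeff \<mu> u u)" for \<mu>
    by (simp add: lookup_sum sos_product_coeff_def)
  have "(\<Sum>j=1..r. \<Sum>k=1..s. sos_const (\<alpha> i j k) * sos_x j * sos_y k) ^ 2 =
      (\<Sum>u\<in>J. \<Sum>v\<in>J. sos_const (a i u * a i v) * (sos_xy u * sos_xy v))" for i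
  proof -
    have "(\<Sum>j=1..r. \<Sum>k=1..s. sos_const (\<alpha> i j k) * sos_x j * sos_y k) =
        (\<Sum>u\<in>J. sos_const (a i u) * sos_xy u)"
      unfolding J_def sum.cartesian_product
      by (intro sum.cong) (auto simp: sos_xy_def a_def mult.assoc)
    moreover have "sos_const (a i u) * sos_xy u * (sos_const (a i v) * sos_xy v) =
        sos_const (a i u * a i v) * (sos_xy u * sos_xy v)" for u v
      unfolding const[symmetric] by (simp only: mult_ac)
    ultimately show ?thesis
      by (simp only: power2_eq_square sum_product)
  qed
  then have rhs: "Poly_Mapping.lookup (\<Sum>i=1..n. (\<Sum>j=1..r. \<Sum>k=1..s. sos_const (\<alpha> i j k) * sos_x j * sos_y k) ^ 2) \<mu> =
      (\<Sum>i=1..n. \<Sum>u\<in>J. \<Sum>v\<in>J. a i u * a i v * sos_product_coeff \<mu> u v)" for \<mu>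
    by (simp add: lookup_sum lookup_sos_const_times sos_product_coeff_def)
  show ?thesis
    unfolding poly_mapping_eq_iff fun_eq_iff lhs rhs J_def[symmetric] a_def by (rule iffI; simp)
qed

lemma frobenius_fixed_subfield:
  assumes p: "prime CHAR('a::field)"
  shows "subfield {c :: 'a. c ^ (CHAR('a) ^ k) = c} ring_of_type_algebra"
proof -
  define R where "R = (ring_of_type_algebra :: 'a ring)"
  interpret R: Ring.field R unfolding R_def by (rule field_from_type_algebra)
  have R: "carrier R = UNIV" "monoid.mult R = (*)" "ring.add R = (+)" "monoid.one R = 1" "ring.zero R = 0"
    by (auto simp: R_def ring_of_type_algebra_def)
  have a_inv: "a_inv R x = - x" for x
    using R.minus_equality[of "- x" x] by (simp add: R)
  have m_inv: "m_inv R x = inverse x" if "x \<noteq> 0" for x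
    using that by (intro R.comm_inv_char) (simp_all add: R)
  have minus: "(- x) ^ (CHAR('a) ^ k) = - (x ^ (CHAR('a) ^ k))" for x :: 'a
    using frobenius_diff[OF p, of 0 x k] prime_gt_0_nat[OF p] by (simp add: power_0_left)
  show ?thesis unfolding R_def[symmetric]
    by (intro R.subfieldI' R.subringI)
      (auto simp: R a_inv m_inv minus power_mult_distrib freshmans_dream'[OF p refl] power_inverse)
qed

text \<open>Up to an enumeration \<open>\<epsilon>\<close> of the coefficients of the \<open>z\<^sub>i\<close>, comparing coefficients turns
  the identity into quadratic equations over the prime field.\<close>

definition sos_equation ::
  "(nat \<times> nat \<times> nat \<Rightarrow> nat) \<Rightarrow> nat \<Rightarrow> nat \<Rightarrow> nat \<Rightarrow> (sos_var \<Rightarrow>\<^sub>0 nat) \<Rightarrow> (nat \<Rightarrow> 'a::field) \<Rightarrow> 'a" where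
  "sos_equation \<epsilon> r s n \<mu> x =
     (\<Sum>i=1..n. \<Sum>u\<in>{1..r}\<times>{1..s}. \<Sum>v\<in>{1..r}\<times>{1..s}.
        x (\<epsilon> (i, u)) * x (\<epsilon> (i, v)) * sos_product_coeff \<mu> u v) -
     (\<Sum>u\<in>{1..r}\<times>{1..s}. sos_product_coeff \<mu> u u)"

lemma poly_fun_sos_equation:
  assumes "\<And>i u. i \<in> {1..n} \<Longrightarrow> u \<in> {1..r}\<times>{1..s} \<Longrightarrow> \<epsilon> (i, u) < N"
  shows "poly_fun N 2 (sos_equation \<epsilon> r s n \<mu>)"
proof -
  have "poly_fun N (1 + 1) (\<lambda>x. c * (x i * x j))" if "i < N" "j < N" for i j and c :: 'a
    using that poly_fun_var[of _ N 0, where 'a = 'a] by (intro poly_fun_cmult poly_fun_mult) auto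
  then have "poly_fun N 2 (\<lambda>x. x i * x j * c)" if "i < N" "j < N" for i j and c :: 'a
    using that by (simp add: mult.commute numeral_2_eq_2)
  then show ?thesis
    unfolding sos_equation_def[abs_def] using assms
    by (intro poly_fun_diff poly_fun_sum poly_fun.const) auto
qed

lemma sos_equation_frobenius:
  fixes x :: "nat \<Rightarrow> 'a::field"
  assumes "prime CHAR('a)"
  shows "sos_equation \<epsilon> r s n \<mu> (\<lambda>i. x i ^ CHAR('a)) = sos_equation \<epsilon> r s n \<mu> x ^ CHAR('a)"
proof -
  have "sos_product_coeff \<mu> u v ^ CHAR('a) = (sos_product_coeff \<mu> u v :: 'a)" for u v
    using sos_product_coeff_cases[of \<mu> u v, where 'a = 'a] prime_gt_0_nat[OF assms] by auto
  moreover have "(a - b) ^ CHAR('a) = a ^ CHAR('a) - b ^ CHAR('a)" for a b :: 'a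
    using frobenius_diff[OF assms, of a b 1] by simp
  ultimately show ?thesis
    unfolding sos_equation_def by (simp add: freshmans_dream_sum[OF assms refl] power_mult_distrib)
qed

theorem theorem1p4:
  fixes r s n p :: nat
  assumes "r > 0" and "s > 0" and "n > 0"
    and "prime p" and "odd p"
    and "card (UNIV :: 'f::field set) = p"
    and "sums_of_squares_formula (UNIV :: 'f alg_closure set) r s n"
  shows "\<exists>k :: nat. 0 < k \<and> k \<le> 2 * 17 ^ (r * s * n + r^2 * s^2) \<and>
    (\<exists>F :: 'f alg_closure set.
       subfield F ring_of_type_algebra \<and> card F = p ^ k \<and> sums_of_squares_formula F r s n)"
proof -
  \<comment> \<open>The characteristic divides the prime \<open>p\<close> and is not 1, so it equals
    \<open>p\<close>; the algebraic closure has the same characteristic.\<close>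
  have "CHAR('f) dvd p" using CHAR_dvd_CARD[where 'a = 'f] assms(6) by simp
  then have char: "CHAR('f alg_closure) = p"
    using assms(4) CHAR_not_1'[where 'a = 'f] by (auto simp: prime_nat_iff)
  then have prime: "prime CHAR('f alg_closure)" using assms(4) by simp
  define N where "N = r * s * n"
  define A where "A = {1..n} \<times> {1..r} \<times> {1..s}"
  have "card A = N" by (simp add: A_def N_def)
  then obtain \<epsilon> where \<epsilon>: "bij_betw \<epsilon> A {0..<N}"
    using ex_bij_betw_finite_nat[of A] by (auto simp: A_def)
  have \<epsilon>_less: "\<epsilon> (i, u) < N" if "i \<in> {1..n}" "u \<in> {1..r} \<times> {1..s}" for i u
    using bij_betwE[OF \<epsilon>] that by (auto simp: A_def)
  define F :: "((nat \<Rightarrow> 'f alg_closure) \<Rightarrow> 'f alg_closure) set" where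
    "F = range (sos_equation \<epsilon> r s n)"
  have quadratic: "poly_fun N 2 (sos_equation \<epsilon> r s n \<mu> :: _ \<Rightarrow> 'f alg_closure)" for \<mu>
    by (rule poly_fun_sos_equation) (rule \<epsilon>_less)
  obtain \<alpha> :: "nat \<Rightarrow> nat \<Rightarrow> nat \<Rightarrow> 'f alg_closure" where
    "(\<Sum>j=1..r. sos_x j ^ 2) * (\<Sum>k=1..s. sos_y k ^ 2) =
      (\<Sum>i=1..n. (\<Sum>j=1..r. \<Sum>k=1..s. sos_const (\<alpha> i j k) * sos_x j * sos_y k) ^ 2)"
    using assms(7) unfolding sums_of_squares_formula_def by blast
  note \<alpha> = this[unfolded sos_coefficients, rule_format]
  define z where "z = (\<lambda>t. case inv_into A \<epsilon> t of (i, j, k) \<Rightarrow> \<alpha> i j k)"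
  have z: "z (\<epsilon> (i, u)) = \<alpha> i (fst u) (snd u)" if "i \<in> {1..n}" "u \<in> {1..r} \<times> {1..s}" for i u
    using that bij_betw_inv_into_left[OF \<epsilon>, of "(i, u)"]
    by (auto simp: z_def A_def split: prod.splits)
  have "sos_equation \<epsilon> r s n \<mu> z = 0" for \<mu>
    unfolding sos_equation_def using \<alpha>[of \<mu>] by (simp add: z)
  then have "\<exists>x. \<forall>f\<in>F. f x = 0" by (auto simp: F_def)
  moreover have "N > 0" using assms by (simp add: N_def)
  moreover have "poly_fun N 2 f" "f (\<lambda>i. x i ^ CHAR('f alg_closure)) = f x ^ CHAR('f alg_closure)"
    if "f \<in> F" for f x
    using that quadratic sos_equation_frobenius[OF prime] unfolding F_def by blast+
  ultimately have "\<exists>k x. 0 < k \<and> k \<le> 6 ^ N \<and> (\<forall>f\<in>F. f x = 0) \<and>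
      (\<forall>i<N. x i ^ (CHAR('f alg_closure) ^ k) = x i)"
    by (intro zero_of_small_degree[OF prime])
  then obtain k x where k: "0 < k" "k \<le> 6 ^ N" and zero: "\<forall>f\<in>F. f x = 0"
    and fixed: "\<And>i. i < N \<Longrightarrow> x i ^ (p ^ k) = x i"
    unfolding char by metis
  have x: "sos_equation \<epsilon> r s n \<mu> x = 0" for \<mu>
    using bspec[OF zero, of "sos_equation \<epsilon> r s n \<mu>"] by (simp add: F_def)
  \<comment> \<open>The roots of \<open>X ^ (p ^ k) - X\<close> form the subfield with
    \<open>p ^ k\<close> elements of the algebraic closure.\<close>
  define E where "E = {c :: 'f alg_closure. c ^ (p ^ k) = c}"
  have "subfield E ring_of_type_algebra"
    using frobenius_fixed_subfield[OF prime, of k] by (simp add: E_def char del: CHAR_alg_closure)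
  moreover have "card E = p ^ k"
    using card_frobenius_fixed[OF prime k(1)] by (simp add: E_def char del: CHAR_alg_closure)
  moreover have "sums_of_squares_formula E r s n"
    unfolding sums_of_squares_formula_def
  proof (intro exI[of _ "\<lambda>i j k. x (\<epsilon> (i, j, k))"] conjI ballI)
    show "x (\<epsilon> (i, j, l)) \<in> E" if "i \<in> {1..n}" "j \<in> {1..r}" "l \<in> {1..s}" for i j l
      using that fixed[OF \<epsilon>_less[of i "(j, l)"]] by (simp add: E_def)
  next
    show "(\<Sum>j=1..r. sos_x j ^ 2) * (\<Sum>k=1..s. sos_y k ^ 2) =
      (\<Sum>i=1..n. (\<Sum>j=1..r. \<Sum>k=1..s. sos_const (x (\<epsilon> (i, j, k))) * sos_x j * sos_y k) ^ 2)"
      unfolding sos_coefficients using x by (simp add: sos_equation_def)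
  qed
  moreover have "k \<le> 2 * 17 ^ (r * s * n + r^2 * s^2)"
  proof -
    have "(6 :: nat) ^ N \<le> 17 ^ N" by (rule power_mono) auto
    also have "\<dots> \<le> 17 ^ (r * s * n + r^2 * s^2)" unfolding N_def by (rule power_increasing) auto
    finally show ?thesis using k(2) by linarith
  qed
  ultimately show ?thesis using k(1) by blast
qed

end
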